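(* For every $\tau \in A_0$, the $h_\tau$-dimensional packing measure of the limit set $J_\tau$ of the CIFS $S_\tau$ of generalized complex continued fractions is finite: $\mathcal{P}^{h_\tau}(J_\tau) < \infty$.
   Context: $\mathbb{N}$ denotes the set of positive integers, and $\mathbb{C}$ is identified with $\mathbb{R}^2$ with the Euclidean distance. Let $A_0 := \{\tau = u + iv \in \mathbb{C} \mid u \geq 0 \text{ and } v \geq 1\}$ and $X := \{z \in \mathbb{C} \mid |z - 1/2| \leq 1/2\}$. For $\tau \in A_0$ let $I_\tau := \{m + n\tau \in \mathbb{C} \mid m, n \in \mathbb{N}\}$. For $b \in I_\tau$ define $\phi_b : X \to X$ by $\phi_b(z) := \frac{1}{z+b}$. The family $S_\tau := \{\phi_b : X \to X \mid b \in I_\tau\}$ is called the CIFS (conformal iterated function system) of generalized complex continued fractions. For each infinite sequence $w = w_1 w_2 w_3 \cdots \in I_\tau^{\mathbb{N}}$, the set $\bigcap_{n \in \mathbb{N}} \phi_{w_1} \circ \cdots \circ \phi_{w_n}(X)$ is a singleton; the limit set of $S_\tau$ is $$J_\tau := \bigcup_{w \in I_\tau^{\mathbb{N}}} \bigcap_{n \in \mathbb{N}} \phi_{w_1} \circ \phi_{w_2} \circ \cdots \circ \phi_{w_n}(X) \subset X.$$ $h_\tau := \dim_{\mathcal{H}} J_\tau$ is the Hausdorff dimension of $J_\tau$ with respect to the Euclidean distance. For $s \geq 0$, $\mathcal{P}^s$ denotes the $s$-dimensional packing measure. *)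

theory Defs
  imports "HOL-Analysis.Analysis"
begin

(* The library's diameter is a real number and meaningful only for bounded sets; the covers in
   hausdorff_pre are therefore required to be bounded.  The case s = 0 is separated because
   0 powr 0 = 0, whereas a nonempty set must count 1 (and the empty set 0) in dimension 0. *)
definition diam_pow :: "real \<Rightarrow> 'a::metric_space set \<Rightarrow> ennreal" where
  "diam_pow s U =
     (if U = {} then 0 else if s = 0 then 1 else ennreal (diameter U powr s))"

definition hausdorff_pre :: "real \<Rightarrow> real \<Rightarrow> 'a::metric_space set \<Rightarrow> ennreal" where
  "hausdorff_pre s \<delta> A =
     (INF U \<in> {U :: nat \<Rightarrow> 'a set. A \<subseteq> (\<Union>i. U i) \<and> (\<forall>i. bounded (U i) \<and> diameter (U i) \<le> \<delta>)}.
        \<Sum>i. diam_pow s (U i))"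

definition hausdorff_measure :: "real \<Rightarrow> 'a::metric_space set \<Rightarrow> ennreal" where
  "hausdorff_measure s A = (SUP \<delta> \<in> {0<..}. hausdorff_pre s \<delta> A)"

(* In a Euclidean space the set below contains every s > DIM('a), so the real infimum is over a
   nonempty set that is bounded below; in a general metric space it could be empty. *)
definition hausdorff_dim :: "'a::euclidean_space set \<Rightarrow> real" where
  "hausdorff_dim A = Inf {s. 0 \<le> s \<and> hausdorff_measure s A = 0}"

(* The countable families of disjoint closed balls of radius at most \<delta> centred in A; a ball is
   encoded by the pair of its centre and its radius. *)
definition packings :: "real \<Rightarrow> 'a::metric_space set \<Rightarrow> ('a \<times> real) set set" where
  "packings \<delta> A =
     {P. countable P \<and> (\<forall>(x, r) \<in> P. x \<in> A \<and> 0 < r \<and> r \<le> \<delta>) \<and>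
         disjoint_family_on (\<lambda>(x, r). cball x r) P}"

definition packing_pre :: "real \<Rightarrow> real \<Rightarrow> 'a::euclidean_space set \<Rightarrow> ennreal" where
  "packing_pre s \<delta> A =
     (SUP P \<in> packings \<delta> A. \<Sum>\<^sub>\<infinity>(x, r)\<in>P. ennreal ((2 * r) powr s))"

definition packing_premeasure :: "real \<Rightarrow> 'a::euclidean_space set \<Rightarrow> ennreal" where
  "packing_premeasure s A = (INF \<delta> \<in> {0<..}. packing_pre s \<delta> A)"

(* The premeasure is not countably subadditive, hence the infimum over countable covers. *)
definition packing_measure :: "real \<Rightarrow> 'a::euclidean_space set \<Rightarrow> ennreal" where
  "packing_measure s A =
     (INF F \<in> {F :: nat \<Rightarrow> 'a set. A \<subseteq> (\<Union>i. F i)}. \<Sum>i. packing_premeasure s (F i))"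

primrec word_map :: "('i \<Rightarrow> 'a \<Rightarrow> 'a) \<Rightarrow> (nat \<Rightarrow> 'i) \<Rightarrow> nat \<Rightarrow> 'a \<Rightarrow> 'a" where
  "word_map f w 0 = id"
| "word_map f w (Suc n) = word_map f w n \<circ> f (w n)"

(* Words are indexed from 0, so word_map f w n is the composition of the first n maps of w. *)
definition limit_set :: "('i \<Rightarrow> 'a \<Rightarrow> 'a) \<Rightarrow> 'i set \<Rightarrow> 'a set \<Rightarrow> 'a set" where
  "limit_set f I X = (\<Union>w \<in> {w. \<forall>k. w k \<in> I}. \<Inter>n \<in> {1..}. word_map f w n ` X)"

definition gccf_params :: "complex set" where
  "gccf_params = {\<tau>. 0 \<le> Re \<tau> \<and> 1 \<le> Im \<tau>}"

definition gccf_space :: "complex set" where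
  "gccf_space = {z. cmod (z - 1 / 2) \<le> 1 / 2}"

definition gccf_index :: "complex \<Rightarrow> complex set" where
  "gccf_index \<tau> = {of_nat m + of_nat n * \<tau> | m n :: nat. 1 \<le> m \<and> 1 \<le> n}"

definition gccf_map :: "complex \<Rightarrow> complex \<Rightarrow> complex" where
  "gccf_map b z = 1 / (z + b)"

definition gccf_limit_set :: "complex \<Rightarrow> complex set" where
  "gccf_limit_set \<tau> = limit_set gccf_map (gccf_index \<tau>) gccf_space"

definition gccf_dim :: "complex \<Rightarrow> real" where
  "gccf_dim \<tau> = hausdorff_dim (gccf_limit_set \<tau>)"

end

theory Submission
  imports Defs
begin

text \<open>
  Suppose that the packing sums in dimension \<open>h\<close> were unbounded. Up to a constant, the number \<open>r\<^sup>h\<close> of a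
  ball of radius \<open>r\<close> centred in the limit set is at most the sum of the \<open>h\<close>-th powers of the
  contraction ratios of finitely many pairwise disjoint cylinders inside that ball; because of the
  infinite alphabet, these are in general not a single cylinder but a square of neighbouring
  letters, and there \<open>h \<le> 2\<close> is used. The cylinders chosen in the balls of a packing with a large sum
  thus form a finite, strongly separated iterated function system whose ratios satisfy
  \<open>\<Sum> c\<^sup>h > 1\<close>. Its attractor lies in the limit set and has dimension greater than \<open>h\<close>, which is
  absurd for \<open>h\<close> the dimension of the limit set. No conformal measure is needed.
\<close>

section \<open>Hausdorff and packing measures\<close>

text \<open>A cylinder contained in a packing ball can be far smaller than the ball although its
  parent already sticks out: a letter \<open>b\<close> contracts by a factor of order
  \<open>1 / (cmod b)\<^sup>2\<close>, which has no positive lower bound. The distortion constants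
  do not depend on the word, so the parent map can be undone, which leaves a ball of radius \<rho>
  around a point \<open>gccf_map b y\<close>. The two-dimensional lattice makes up for the loss: the
  N * N chosen letters have ratios at least of order \<rho> / N, so their h-th powers add up to at
  least order N^(2 - h) * \<rho>^h, and this dominates \<rho>^h because h \<le> 2. The contradiction
  is strict because the sum of the s-th powers of finitely many ratios is continuous in s: an excess
  over 1 at h persists at some s > h. Since the estimate covers all radii up to 1/4, that single
  scale, with the limit set covered by itself, bounds the packing measure.\<close>

lemma diam_pow_pos: "0 < t \<Longrightarrow> diam_pow t U = ennreal (diameter U powr t)"
  by (auto simp: diam_pow_def diameter_def)

text \<open>
  Induction on the number of covering sets: a set of diameter at least the gap \<open>d\<close> suffices by
  itself, and otherwise each set meets at most one piece \<open>f i ` E\<close>, so that every piece is covered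
  by strictly fewer sets, which \<open>f i\<close> pulls back to a cover of \<open>E\<close>.
\<close>

lemma finite_cover_diameter_sum_ge:
  fixes f :: "'i \<Rightarrow> 'a::euclidean_space \<Rightarrow> 'a"
  assumes t: "0 < t" and W: "finite W" "2 \<le> card W" and E: "E \<noteq> {}" "bounded E"
    and inv: "\<And>i. i \<in> W \<Longrightarrow> f i ` E \<subseteq> E"
    and c: "\<And>i. i \<in> W \<Longrightarrow> 0 < c i"
    and low: "\<And>i x y. i \<in> W \<Longrightarrow> x \<in> E \<Longrightarrow> y \<in> E \<Longrightarrow> c i * dist x y \<le> dist (f i x) (f i y)"
    and gap: "\<And>i j x y. i \<in> W \<Longrightarrow> j \<in> W \<Longrightarrow> i \<noteq> j \<Longrightarrow> x \<in> E \<Longrightarrow> y \<in> E \<Longrightarrow> d \<le> dist (f i x) (f j y)"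
    and d: "0 < d"
    and sum1: "1 \<le> (\<Sum>i\<in>W. c i powr t)"
  shows "finite A \<Longrightarrow> E \<subseteq> (\<Union>j\<in>A. U j) \<Longrightarrow> (\<And>j. j \<in> A \<Longrightarrow> bounded (U j)) \<Longrightarrow>
      d powr t \<le> (\<Sum>j\<in>A. diameter (U j :: 'a set) powr t)"
proof (induction "card A" arbitrary: A U rule: less_induct)
  case less
  note finA = less.prems(1) and cov = less.prems(2) and bU = less.prems(3)
  show ?case
  proof (cases "\<exists>j\<in>A. d \<le> diameter (U j)")
    case True
    then obtain j where j: "j \<in> A" "d \<le> diameter (U j)" by blast
    have "d powr t \<le> diameter (U j) powr t" using j d t by (intro powr_mono2) auto
    also have "\<dots> \<le> (\<Sum>j\<in>A. diameter (U j) powr t)"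
      using j finA by (intro member_le_sum) auto
    finally show ?thesis .
  next
    case False
    define A' where "A' i = {j\<in>A. U j \<inter> f i ` E \<noteq> {}}" for i
    have disj: "A' i \<inter> A' k = {}" if "i \<in> W" "k \<in> W" "i \<noteq> k" for i k
    proof (rule ccontr)
      assume "A' i \<inter> A' k \<noteq> {}"
      then obtain j x y where j: "j \<in> A" "x \<in> E" "y \<in> E" "f i x \<in> U j" "f k y \<in> U j"
        by (auto simp: A'_def)
      have "dist (f i x) (f k y) \<le> diameter (U j)"
        using j bU by (intro diameter_bounded_bound) auto
      with gap[OF that j(2,3)] False j(1) show False by force
    qed
    have ne: "A' i \<noteq> {}" if i: "i \<in> W" for i
    proof -
      obtain x where x: "x \<in> E" using E by blast
      then have "f i x \<in> E" using inv i by blast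
      then obtain j where "j \<in> A" "f i x \<in> U j" using cov by blast
      with x show ?thesis by (auto simp: A'_def)
    qed
    \<comment> \<open>Strictness comes from a second piece, which needs a covering set of its
      own.\<close>
    have sub: "A' i \<subset> A" if i: "i \<in> W" for i
    proof -
      have "\<exists>k\<in>W. k \<noteq> i"
      proof (rule ccontr)
        assume "\<not> ?thesis"
        then have "W \<subseteq> {i}" by blast
        then have "card W \<le> 1" using card_mono[of "{i}" W] by simp
        with W show False by simp
      qed
      then obtain k where k: "k \<in> W" "k \<noteq> i" by blast
      have "A' i \<subseteq> A" "A' k \<subseteq> A" by (auto simp: A'_def)
      with disj[OF i k(1)] ne[OF k(1)] k show ?thesis by blast
    qed
    have step: "c i powr t * d powr t \<le> (\<Sum>j\<in>A' i. diameter (U j) powr t)" if i: "i \<in> W" for i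
    proof -
      define V where "V j = {x\<in>E. f i x \<in> U j}" for j
      have bV: "bounded (V j)" for j
        by (rule bounded_subset[OF E(2)]) (auto simp: V_def)
      have "d powr t \<le> (\<Sum>j\<in>A' i. diameter (V j) powr t)"
      proof (rule less.hyps)
        show "card (A' i) < card A" using psubset_card_mono[OF finA sub[OF i]] .
        show "finite (A' i)" using finA by (auto simp: A'_def)
        show "E \<subseteq> (\<Union>j\<in>A' i. V j)"
        proof
          fix x assume x: "x \<in> E"
          then have "f i x \<in> E" using inv i by blast
          then obtain j where "j \<in> A" "f i x \<in> U j" using cov by blast
          with x show "x \<in> (\<Union>j\<in>A' i. V j)" by (auto simp: A'_def V_def)
        qed
      qed (rule bV)
      also have "\<dots> \<le> (\<Sum>j\<in>A' i. (diameter (U j) / c i) powr t)"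
      proof (rule sum_mono)
        fix j assume j: "j \<in> A' i"
        have "diameter (V j) \<le> diameter (U j) / c i"
        proof (rule diameter_le)
          show "V j \<noteq> {} \<or> 0 \<le> diameter (U j) / c i"
            using j by (auto simp: A'_def V_def)
          fix x y assume xy: "x \<in> V j" "y \<in> V j"
          then have "c i * dist x y \<le> dist (f i x) (f i y)" using low i by (auto simp: V_def)
          also have "\<dots> \<le> diameter (U j)"
            using xy j bU by (intro diameter_bounded_bound) (auto simp: V_def A'_def)
          finally have "dist x y \<le> diameter (U j) / c i" using c[OF i] by (simp add: field_simps)
          then show "norm (x - y) \<le> diameter (U j) / c i" by (simp add: dist_norm)
        qed
        moreover have "0 \<le> diameter (V j)" using bV by (rule diameter_ge_0)
        ultimately show "diameter (V j) powr t \<le> (diameter (U j) / c i) powr t"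
          using t by (intro powr_mono2) auto
      qed
      also have "\<dots> = (\<Sum>j\<in>A' i. diameter (U j) powr t) / c i powr t"
      proof -
        have "(diameter (U j) / c i) powr t = diameter (U j) powr t / c i powr t" if "j \<in> A' i" for j
          by (rule powr_divide)
        then show ?thesis by (simp add: sum_divide_distrib)
      qed
      finally show ?thesis using c[OF i] by (simp add: field_simps)
    qed
    have "d powr t \<le> (\<Sum>i\<in>W. c i powr t) * d powr t" using sum1 d by simp
    also have "\<dots> \<le> (\<Sum>i\<in>W. \<Sum>j\<in>A' i. diameter (U j) powr t)"
      unfolding sum_distrib_right by (intro sum_mono step)
    also have "\<dots> = (\<Sum>j\<in>(\<Union>i\<in>W. A' i). diameter (U j) powr t)"
      using disj W finA by (intro sum.UNION_disjoint[symmetric]) (auto simp: A'_def)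
    also have "\<dots> \<le> (\<Sum>j\<in>A. diameter (U j) powr t)"
      using finA by (intro sum_mono2) (auto simp: A'_def)
    finally show ?thesis .
  qed
qed


text \<open>Hausdorff covers consist of arbitrary bounded sets, while compactness needs open ones.
  Thickening by \<eta> raises the diameter by at most 2\<eta>, and \<open>0 < t\<close> makes the
  power continuous even at diameter 0.\<close>

lemma open_enlargement_diameter_powr:
  fixes U :: "'a::euclidean_space set"
  assumes "bounded U" "0 < e" "0 < t"
  shows "\<exists>V. open V \<and> U \<subseteq> V \<and> bounded V \<and> diameter V powr t \<le> diameter U powr t + e"
proof (cases "U = {}")
  case True
  then show ?thesis using assms by (intro exI[of _ "{}"]) auto
next
  case False
  have "((\<lambda>\<eta>. (diameter U + 2 * \<eta>) powr t) \<longlongrightarrow> (diameter U + 2 * 0) powr t) (at_right 0)"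
    using assms diameter_ge_0[OF assms(1)]
    by (intro tendsto_powr' tendsto_intros) (auto simp: eventually_at_filter)
  then have "\<forall>\<^sub>F \<eta> in at_right 0. (diameter U + 2 * \<eta>) powr t < diameter U powr t + e"
    by (rule order_tendstoD) (use assms in auto)
  moreover have "\<forall>\<^sub>F \<eta> in at_right (0::real). 0 < \<eta>" by (rule eventually_at_right_less)
  ultimately have "\<forall>\<^sub>F \<eta> in at_right 0. 0 < \<eta> \<and> (diameter U + 2 * \<eta>) powr t < diameter U powr t + e"
    by eventually_elim simp
  then obtain \<eta> where \<eta>: "0 < \<eta>" "(diameter U + 2 * \<eta>) powr t < diameter U powr t + e"
    using eventually_happens'[OF trivial_limit_at_right_real] by blast
  define V where "V = (\<Union>x\<in>U. ball x \<eta>)"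
  have d: "dist x y \<le> diameter U + 2 * \<eta>" if xy: "x \<in> V" "y \<in> V" for x y
  proof -
    obtain a b where ab: "a \<in> U" "b \<in> U" "dist a x < \<eta>" "dist b y < \<eta>"
      using xy by (auto simp: V_def)
    have "dist a b \<le> diameter U" using assms(1) ab by (intro diameter_bounded_bound)
    moreover have "dist x y \<le> dist a x + dist a b + dist b y"
      using dist_triangle[of x y a] dist_triangle[of a y b] by (simp add: dist_commute)
    ultimately show ?thesis using ab by linarith
  qed
  have "bounded V"
    unfolding bounded_two_points by (intro exI ballI) (rule d)
  moreover have "diameter V \<le> diameter U + 2 * \<eta>"
    using d \<eta> diameter_ge_0[OF assms(1)] by (intro diameter_le) (auto simp: dist_norm)
  then have "diameter V powr t \<le> (diameter U + 2 * \<eta>) powr t"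
    using assms diameter_ge_0[OF \<open>bounded V\<close>] by (intro powr_mono2) auto
  moreover have "open V" "U \<subseteq> V" using \<eta> by (auto simp: V_def)
  ultimately show ?thesis using \<eta> by (intro exI[of _ V]) auto
qed

text \<open>If the sum fell short of \<open>d powr t\<close> by e, half of e could be spent on open
  enlargements, in geometrically decreasing shares; a finite subcover would then contradict the
  finite case.\<close>

lemma countable_cover_diam_pow_sum_ge:
  fixes f :: "'i \<Rightarrow> 'a::euclidean_space \<Rightarrow> 'a"
  assumes t: "0 < t" and W: "finite W" "2 \<le> card W" and E: "E \<noteq> {}" "compact E"
    and inv: "\<And>i. i \<in> W \<Longrightarrow> f i ` E \<subseteq> E"
    and c: "\<And>i. i \<in> W \<Longrightarrow> 0 < c i"
    and low: "\<And>i x y. i \<in> W \<Longrightarrow> x \<in> E \<Longrightarrow> y \<in> E \<Longrightarrow> c i * dist x y \<le> dist (f i x) (f i y)"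
    and gap: "\<And>i j x y. i \<in> W \<Longrightarrow> j \<in> W \<Longrightarrow> i \<noteq> j \<Longrightarrow> x \<in> E \<Longrightarrow> y \<in> E \<Longrightarrow> d \<le> dist (f i x) (f j y)"
    and d: "0 < d"
    and sum1: "1 \<le> (\<Sum>i\<in>W. c i powr t)"
    and cov: "E \<subseteq> (\<Union>j. U j)" and bU: "\<And>j::nat. bounded (U j)"
  shows "ennreal (d powr t) \<le> (\<Sum>j. diam_pow t (U j))"
proof (rule ccontr)
  define a where "a j = diameter (U j) powr t" for j
  assume "\<not> ?thesis"
  then have lt: "(\<Sum>j. ennreal (a j)) < ennreal (d powr t)"
    using t by (simp add: diam_pow_pos a_def not_le)
  then have fin: "(\<Sum>j. ennreal (a j)) \<noteq> top" by auto
  have a0: "0 \<le> a j" for j by (simp add: a_def)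
  have sa: "summable a" using summable_suminf_not_top[OF a0 fin] .
  have "ennreal (suminf a) < ennreal (d powr t)" using lt suminf_ennreal2[OF a0 sa] by simp
  then have lt': "suminf a < d powr t" by (simp add: ennreal_less_iff suminf_nonneg[OF sa a0])
  define e where "e = d powr t - suminf a"
  have e: "0 < e" using lt' by (simp add: e_def)
  have "\<exists>V. open V \<and> U j \<subseteq> V \<and> bounded V \<and> diameter V powr t \<le> a j + e / 2 * (1/2) ^ Suc j" for j
    unfolding a_def using e by (intro open_enlargement_diameter_powr bU t) simp
  then obtain V where V: "\<And>j. open (V j)" "\<And>j. U j \<subseteq> V j" "\<And>j. bounded (V j)"
    "\<And>j. diameter (V j) powr t \<le> a j + e / 2 * (1/2) ^ Suc j" by metis
  have "E \<subseteq> (\<Union>j\<in>UNIV. V j)" using cov V(2) by blast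
  then obtain A where A: "finite A" "E \<subseteq> (\<Union>j\<in>A. V j)"
    using compactE_image[OF E(2), of UNIV V] V(1) by (metis subset_UNIV)
  have sums: "(\<lambda>j. a j + e / 2 * (1/2) ^ Suc j) sums (suminf a + e / 2 * 1)"
    by (intro sums_add sums_mult summable_sums sa power_half_series)
  have "d powr t \<le> (\<Sum>j\<in>A. diameter (V j) powr t)"
    by (rule finite_cover_diameter_sum_ge[OF t W E(1) compact_imp_bounded[OF E(2)] inv c low gap d sum1 A])
       (auto intro: V)
  also have "\<dots> \<le> (\<Sum>j\<in>A. a j + e / 2 * (1/2) ^ Suc j)" by (intro sum_mono V)
  also have "\<dots> \<le> (\<Sum>j. a j + e / 2 * (1/2) ^ Suc j)"
    using e a0 by (intro sum_le_suminf A sums_summable[OF sums]) auto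
  also have "\<dots> = suminf a + e / 2" using sums_unique[OF sums] by simp
  finally show False using e e_def by linarith
qed

text \<open>The attractor is the nested intersection of the iterated images of X. For the inclusion
  into the union of its own images, a point has a representation \<open>f j y\<close> at every
  level; disjointness makes the map, and injectivity the preimage, the same at all levels.\<close>

lemma exists_attractor:
  fixes f :: "'i \<Rightarrow> 'a::euclidean_space \<Rightarrow> 'a"
  assumes W: "finite W" "W \<noteq> {}" and X: "compact X" "X \<noteq> {}"
    and cont: "\<And>i. i \<in> W \<Longrightarrow> continuous_on X (f i)"
    and self: "\<And>i. i \<in> W \<Longrightarrow> f i ` X \<subseteq> X"
    and inj: "\<And>i. i \<in> W \<Longrightarrow> inj_on (f i) X"
    and disj: "\<And>i j. i \<in> W \<Longrightarrow> j \<in> W \<Longrightarrow> i \<noteq> j \<Longrightarrow> f i ` X \<inter> f j ` X = {}"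
  obtains E where "compact E" "E \<noteq> {}" "E \<subseteq> X" "\<And>i. i \<in> W \<Longrightarrow> f i ` E \<subseteq> E" "E \<subseteq> (\<Union>i\<in>W. f i ` E)"
proof -
  define F where "F S = (\<Union>i\<in>W. f i ` S)" for S
  define En where "En n = (F ^^ n) X" for n
  have En0: "En 0 = X" and EnS: "En (Suc n) = (\<Union>i\<in>W. f i ` En n)" for n
    by (simp_all add: En_def F_def)
  have dec: "En (Suc n) \<subseteq> En n" for n
  proof (induction n)
    case 0
    then show ?case using self by (auto simp: EnS En0)
  next
    case (Suc n)
    then show ?case unfolding EnS[of "Suc n"] EnS[of n] by (intro UN_mono image_mono) auto
  qed
  have mono: "En n \<subseteq> En m" if "m \<le> n" for m n
    using lift_Suc_antimono_le[of En, OF dec that] .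
  have sub: "En n \<subseteq> X" for n using mono[of 0 n] by (simp add: En0)
  have comp: "compact (En n)" for n
  proof (induction n)
    case 0
    then show ?case using X by (simp add: En0)
  next
    case (Suc n)
    then show ?case unfolding EnS
      by (intro compact_UN W compact_continuous_image continuous_on_subset[OF cont sub])
  qed
  have ne: "En n \<noteq> {}" for n
  proof (induction n)
    case 0
    then show ?case using X by (simp add: En0)
  next
    case (Suc n)
    then show ?case using W by (auto simp: EnS)
  qed
  define E where "E = (\<Inter>n. En n)"
  have EX: "E \<subseteq> X" using sub by (auto simp: E_def)
  show ?thesis
  proof
    show "compact E" unfolding E_def
      by (intro compact_Inter) (auto intro: comp)
    show "E \<noteq> {}" unfolding E_def using compact_nest[of En] comp ne mono by blast
    show "E \<subseteq> X" by (rule EX)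
    show "f i ` E \<subseteq> E" if i: "i \<in> W" for i
    proof
      fix y assume "y \<in> f i ` E"
      then obtain x where x: "x \<in> E" "y = f i x" by blast
      have "y \<in> En (Suc n)" for n using x i by (auto simp: EnS E_def)
      then have "y \<in> En n" for n using dec by blast
      then show "y \<in> E" by (simp add: E_def)
    qed
    show "E \<subseteq> (\<Union>i\<in>W. f i ` E)"
    proof
      fix x assume x: "x \<in> E"
      then have xS: "x \<in> En (Suc n)" for n by (auto simp: E_def)
      from xS[of 0] obtain i z where i: "i \<in> W" "z \<in> X" "x = f i z" by (auto simp: EnS En0)
      have "z \<in> En n" for n
      proof -
        from xS[of n] obtain j y where j: "j \<in> W" "y \<in> En n" "x = f j y" by (auto simp: EnS)
        then have "y \<in> X" using sub by blast
        then have "j = i" using disj[OF j(1) i(1)] j i by blast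
        then have "y = z" using inj[OF i(1)] i j \<open>y \<in> X\<close> by (auto dest: inj_onD)
        then show ?thesis using j by simp
      qed
      then show "x \<in> (\<Union>i\<in>W. f i ` E)" using i by (auto simp: E_def)
    qed
  qed
qed


text \<open>Some s > h still has ratio sum above 1, and so does every smaller exponent because the
  ratios are at most 1. Hence no exponent up to s has measure zero. The hypothesis
  \<open>null\<close> keeps the infimum in \<open>hausdorff_dim\<close> from being taken over the
  empty set.\<close>

lemma hausdorff_dim_gt:
  fixes f :: "'i \<Rightarrow> 'a::euclidean_space \<Rightarrow> 'a"
  assumes W: "finite W" and E: "E \<noteq> {}" "compact E" "E \<subseteq> J"
    and inv: "\<And>i. i \<in> W \<Longrightarrow> f i ` E \<subseteq> E"
    and cont: "\<And>i. i \<in> W \<Longrightarrow> continuous_on E (f i)"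
    and disj: "\<And>i j. i \<in> W \<Longrightarrow> j \<in> W \<Longrightarrow> i \<noteq> j \<Longrightarrow> f i ` E \<inter> f j ` E = {}"
    and c: "\<And>i. i \<in> W \<Longrightarrow> 0 < c i" "\<And>i. i \<in> W \<Longrightarrow> c i \<le> 1"
    and low: "\<And>i x y. i \<in> W \<Longrightarrow> x \<in> E \<Longrightarrow> y \<in> E \<Longrightarrow> c i * dist x y \<le> dist (f i x) (f i y)"
    and h: "0 \<le> h" "1 < (\<Sum>i\<in>W. c i powr h)"
    and null: "\<exists>s\<ge>0. hausdorff_measure s J = 0"
  shows "h < hausdorff_dim J"
proof -
  have "((\<lambda>s. \<Sum>i\<in>W. c i powr s) \<longlongrightarrow> (\<Sum>i\<in>W. c i powr h)) (at_right h)"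
    by (intro tendsto_intros) (use c in force)
  then have "\<forall>\<^sub>F s in at_right h. 1 < (\<Sum>i\<in>W. c i powr s)"
    using h(2) by (rule order_tendstoD)
  moreover have "\<forall>\<^sub>F s in at_right h. h < s" by (rule eventually_at_right_less)
  ultimately have "\<forall>\<^sub>F s in at_right h. h < s \<and> 1 < (\<Sum>i\<in>W. c i powr s)"
    by eventually_elim simp
  then obtain s where s: "h < s" "1 < (\<Sum>i\<in>W. c i powr s)"
    using eventually_happens'[OF trivial_limit_at_right_real] by blast
  have sum1: "1 \<le> (\<Sum>i\<in>W. c i powr t)" if "t \<le> s" for t
  proof -
    have "(\<Sum>i\<in>W. c i powr s) \<le> (\<Sum>i\<in>W. c i powr t)"
      using c that by (intro sum_mono powr_mono') (auto intro: less_imp_le)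
    then show ?thesis using s by simp
  qed
  have "2 \<le> card W"
  proof (rule ccontr)
    assume "\<not> 2 \<le> card W"
    moreover have "(\<Sum>i\<in>W. c i powr h) \<le> of_nat (card W) * 1"
      using c h by (intro sum_bounded_above powr_le1) (auto simp: abs_of_pos)
    ultimately show False using h by linarith
  qed
  \<comment> \<open>Phrasing the gaps as eventual statements for small d merges those of the
    finitely many pairs into a common one.\<close>
  have "\<exists>d>0. \<forall>i\<in>W. \<forall>j\<in>W. i \<noteq> j \<longrightarrow> (\<forall>x\<in>E. \<forall>y\<in>E. d \<le> dist (f i x) (f j y))"
  proof -
    have sep: "\<exists>d>0. \<forall>x\<in>f i ` E. \<forall>y\<in>f j ` E. d \<le> dist x y" if "i \<in> W" "j \<in> W" "i \<noteq> j" for i j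
      using that by (intro separate_compact_closed disj compact_imp_closed compact_continuous_image cont E)
    then have "\<forall>\<^sub>F d in at_right 0. i \<noteq> j \<longrightarrow> (\<forall>x\<in>E. \<forall>y\<in>E. d \<le> dist (f i x) (f j y))"
      if ij: "i \<in> W" "j \<in> W" for i j
    proof (cases "i = j")
      case False
      then obtain e where e: "0 < e" "\<forall>x\<in>f i ` E. \<forall>y\<in>f j ` E. e \<le> dist x y"
        using sep[OF ij False] by blast
      show ?thesis
        unfolding eventually_at_right_field
        by (rule exI[of _ e]) (use e in force)
    qed simp
    then have "\<forall>\<^sub>F d in at_right 0. \<forall>i\<in>W. \<forall>j\<in>W. i \<noteq> j \<longrightarrow> (\<forall>x\<in>E. \<forall>y\<in>E. d \<le> dist (f i x) (f j y))"
      using W by (simp add: eventually_ball_finite)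
    moreover have "\<forall>\<^sub>F d in at_right 0. (0::real) < d" by (rule eventually_at_right_less)
    ultimately have "\<forall>\<^sub>F d in at_right 0. 0 < d \<and>
        (\<forall>i\<in>W. \<forall>j\<in>W. i \<noteq> j \<longrightarrow> (\<forall>x\<in>E. \<forall>y\<in>E. d \<le> dist (f i x) (f j y)))"
      by eventually_elim simp
    then show ?thesis
      using eventually_happens'[OF trivial_limit_at_right_real] by blast
  qed
  then obtain d where d: "0 < d"
    and gap: "\<And>i j x y. i \<in> W \<Longrightarrow> j \<in> W \<Longrightarrow> i \<noteq> j \<Longrightarrow> x \<in> E \<Longrightarrow> y \<in> E \<Longrightarrow> d \<le> dist (f i x) (f j y)"
    by blast
  have pos: "hausdorff_measure t J \<noteq> 0" if t: "0 \<le> t" "t \<le> s" for t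
  proof -
    \<comment> \<open>The minimum with 1 absorbs t = 0, where a nonempty set counts 1 whatever its
      diameter.\<close>
    have "min 1 (ennreal (d powr t)) \<le> (\<Sum>j. diam_pow t (U j))"
      if U: "J \<subseteq> (\<Union>j. U j)" "\<And>j::nat. bounded (U j)" for U
    proof (cases "t = 0")
      case True
      obtain j where "U j \<noteq> {}" using E U by blast
      then have "1 = (\<Sum>i\<in>{j}. diam_pow t (U i))" by (simp add: diam_pow_def True)
      also have "\<dots> \<le> (\<Sum>j. diam_pow t (U j))" by (intro sum_le_suminf) auto
      finally show ?thesis by (simp add: min.coboundedI1)
    next
      case False
      then have "ennreal (d powr t) \<le> (\<Sum>j. diam_pow t (U j))"
        using t E U sum1[OF t(2)]
        by (intro countable_cover_diam_pow_sum_ge[OF _ W \<open>2 \<le> card W\<close> E(1,2) inv c(1) low gap d]) auto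
      then show ?thesis by (simp add: min.coboundedI2)
    qed
    then have "min 1 (ennreal (d powr t)) \<le> hausdorff_pre t 1 J"
      unfolding hausdorff_pre_def by (intro INF_greatest) blast
    also have "\<dots> \<le> hausdorff_measure t J"
      unfolding hausdorff_measure_def by (intro SUP_upper) auto
    finally have "min 1 (ennreal (d powr t)) \<le> hausdorff_measure t J" .
    moreover have "0 < min 1 (ennreal (d powr t))" using d by simp
    ultimately show ?thesis by (metis less_le_trans less_irrefl)
  qed
  have "s \<le> hausdorff_dim J"
    unfolding hausdorff_dim_def using null pos by (intro cInf_greatest) force+
  then show ?thesis using s by simp
qed

text \<open>A grid of N * N squares of diameter at most 2 / N contributes at most N^2 * (2 / N)^s =
  2^s * N^(2 - s), which tends to 0.\<close>

lemma hausdorff_measure_square_zero: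
  assumes A: "\<And>z. z \<in> A \<Longrightarrow> 0 \<le> Re z \<and> Re z \<le> 1 \<and> - 1 / 2 \<le> Im z \<and> Im z \<le> 1 / 2" and s: "2 < s"
  shows "hausdorff_measure s A = 0"
proof -
  have bound: "hausdorff_pre s \<delta> A \<le> ennreal (2 powr s * real N powr (2 - s))"
    if N: "1 \<le> N" "2 / real N \<le> \<delta>" for N :: nat and \<delta>
  proof -
    \<comment> \<open>The single index k encodes column \<open>k div N\<close> and row
      \<open>k mod N\<close>; adding 1/2 moves the imaginary part into [0, 1].\<close>
    define Q where "Q k = {z. Re z \<in> {real (k div N) / N..(real (k div N) + 1) / N} \<and>
        Im z + 1/2 \<in> {real (k mod N) / N..(real (k mod N) + 1) / N}}" for k
    define U where "U k = (if k < N * N then Q k else {})" for k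
    have dist_Q: "dist z w \<le> 2 / N" if "z \<in> Q k" "w \<in> Q k" for z w k
    proof -
      have "\<bar>Re (z - w)\<bar> \<le> 1 / N" "\<bar>Im (z - w)\<bar> \<le> 1 / N"
        using that by (auto simp: Q_def add_divide_distrib abs_le_iff)
      then show ?thesis using cmod_le[of "z - w"] by (simp add: dist_norm)
    qed
    have bU: "bounded (U k)" for k
      unfolding bounded_two_points U_def using dist_Q by (intro exI[of _ "2 / N"]) auto
    have dU: "diameter (U k) \<le> 2 / N" for k
      using dist_Q[of _ k] by (intro diameter_le) (simp_all add: U_def dist_norm split: if_splits)
    have cov: "A \<subseteq> (\<Union>k. U k)"
    proof
      \<comment> \<open>The right end t = 1 is separate: the floor would give the index N, which is
        out of range.\<close>
      have cell: "\<exists>i<N. real i / N \<le> t \<and> t \<le> (real i + 1) / N" if t: "0 \<le> t" "t \<le> 1" for t :: real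
      proof (cases "t = 1")
        case True
        then show ?thesis using N by (intro exI[of _ "N - 1"]) (auto simp: field_simps of_nat_diff)
      next
        case False
        have "nat \<lfloor>t * N\<rfloor> < N" using t False N by (simp add: nat_less_iff floor_less_iff)
        moreover have "real (nat \<lfloor>t * N\<rfloor>) \<le> t * N" "t * N \<le> real (nat \<lfloor>t * N\<rfloor>) + 1"
          using t by (auto simp: of_nat_nat)
        ultimately show ?thesis using N by (intro exI[of _ "nat \<lfloor>t * N\<rfloor>"]) (auto simp: field_simps)
      qed
      fix z assume "z \<in> A"
      then obtain i j where ij: "i < N" "j < N" "real i / N \<le> Re z" "Re z \<le> (real i + 1) / N"
        "real j / N \<le> Im z + 1/2" "Im z + 1/2 \<le> (real j + 1) / N"
        using cell[of "Re z"] cell[of "Im z + 1/2"] A[of z] by auto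
      have "i * N + j < i * N + N" using ij by simp
      also have "\<dots> = Suc i * N" by simp
      also have "\<dots> \<le> N * N" using ij by (intro mult_le_mono) auto
      finally have "z \<in> U (i * N + j)" using ij by (simp add: U_def Q_def)
      then show "z \<in> (\<Union>k. U k)" by blast
    qed
    have "hausdorff_pre s \<delta> A \<le> (\<Sum>k. diam_pow s (U k))"
      unfolding hausdorff_pre_def using cov bU dU N by (intro INF_lower) (auto intro: order_trans)
    also have "\<dots> = (\<Sum>k<N*N. diam_pow s (U k))"
      by (intro suminf_finite) (auto simp: U_def diam_pow_def)
    also have "\<dots> \<le> (\<Sum>k<N*N. ennreal ((2 / N) powr s))"
      using s dU bU by (intro sum_mono) (auto simp: diam_pow_pos intro!: ennreal_leI powr_mono2 diameter_ge_0)
    also have "\<dots> = ennreal (real (N * N) * (2 / N) powr s)"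
      by (simp add: ennreal_mult ennreal_of_nat_eq_real_of_nat)
    also have "real (N * N) * (2 / N) powr s = 2 powr s * real N powr (2 - s)"
      using N by (simp add: powr_divide powr_diff power2_eq_square)
    finally show ?thesis .
  qed
  have "(\<lambda>N. 2 powr s * real N powr (2 - s)) \<longlonglongrightarrow> 2 powr s * 0"
    using s by (intro tendsto_mult tendsto_const tendsto_neg_powr filterlim_real_sequentially) auto
  then have lim: "(\<lambda>N. ennreal (2 powr s * real N powr (2 - s))) \<longlonglongrightarrow> ennreal 0"
    by (intro tendsto_ennrealI) simp
  have "hausdorff_pre s \<delta> A \<le> 0" if \<delta>: "0 < \<delta>" for \<delta>
  proof (rule tendsto_lowerbound[OF lim[unfolded ennreal_0]])
    have "(\<lambda>N. 2 / real N) \<longlonglongrightarrow> 0" by (rule lim_const_over_n)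
    then have "\<forall>\<^sub>F N in sequentially. 2 / real N < \<delta>" using \<delta> by (rule order_tendstoD)
    then show "\<forall>\<^sub>F N in sequentially. hausdorff_pre s \<delta> A \<le> ennreal (2 powr s * real N powr (2 - s))"
      using eventually_ge_at_top[of 1] by eventually_elim (intro bound, auto)
  qed simp
  then show ?thesis unfolding hausdorff_measure_def by (simp add: SUP_eq_iff bot_ennreal)
qed

section \<open>Bounding the packing measure by packings at one scale\<close>

lemma packing_premeasure_le_pre: "0 < \<delta> \<Longrightarrow> packing_premeasure s A \<le> packing_pre s \<delta> A"
  unfolding packing_premeasure_def by (intro INF_lower) simp

lemma packing_premeasure_empty: "packing_premeasure s ({} :: 'a::euclidean_space set) = 0"
proof -
  have "packings \<delta> ({} :: 'a set) = {{}}" for \<delta> by (auto simp: packings_def disjoint_family_on_def)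
  then have "packing_pre s 1 ({} :: 'a set) = 0" by (simp add: packing_pre_def)
  then show ?thesis using packing_premeasure_le_pre[of 1 s "{} :: 'a set"] by simp
qed

lemma packing_measure_le_premeasure: "packing_measure s A \<le> packing_premeasure s A"
proof -
  define F where "F i = (if i = (0::nat) then A else {})" for i
  have "packing_measure s A \<le> (\<Sum>i. packing_premeasure s (F i))"
    unfolding packing_measure_def by (intro INF_lower) (auto simp: F_def intro: exI[of _ 0])
  also have "\<dots> = (\<Sum>i\<in>{0}. packing_premeasure s (F i))"
    by (intro suminf_finite) (auto simp: F_def packing_premeasure_empty)
  finally show ?thesis by (simp add: F_def)
qed

section \<open>Orbits and distortion\<close>

text \<open>Backward invariance suffices: choose for each point of F a letter and a preimage in F.
  Iterating the choice of preimages from x and reading off the letters gives a word coding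
  x.\<close>

lemma subset_limit_setI:
  assumes "F \<subseteq> X" "F \<subseteq> (\<Union>b\<in>I. f b ` F)"
  shows "F \<subseteq> limit_set f I X"
proof
  fix x assume x: "x \<in> F"
  obtain b g where b: "\<And>z. z \<in> F \<Longrightarrow> b z \<in> I" "\<And>z. z \<in> F \<Longrightarrow> g z \<in> F"
      "\<And>z. z \<in> F \<Longrightarrow> f (b z) (g z) = z"
    using assms(2) unfolding subset_eq UN_iff image_iff by metis
  have g: "(g ^^ n) x \<in> F" for n by (induction n) (auto simp: x b)
  define w where "w n = b ((g ^^ n) x)" for n
  have "word_map f w n ((g ^^ n) x) = x" for n
    by (induction n) (simp_all add: w_def b g)
  then have "x \<in> word_map f w n ` X" for n
    using g assms(1) by (metis image_eqI subsetD)
  moreover have "w k \<in> I" for k by (simp add: w_def b g)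
  ultimately show "x \<in> limit_set f I X" by (auto simp: limit_set_def)
qed

text \<open>The intersection gives an unrelated preimage of x at each level; injectivity of the
  composed maps links consecutive ones.\<close>

lemma limit_set_orbit:
  assumes x: "x \<in> limit_set f I X"
    and self: "\<And>b. b \<in> I \<Longrightarrow> f b ` X \<subseteq> X" and inj: "\<And>b. b \<in> I \<Longrightarrow> inj_on (f b) X"
  obtains w z where "\<And>n. w n \<in> I" "\<And>n. z n \<in> X" "\<And>n. word_map f w n (z n) = x"
    "\<And>n. z n = f (w n) (z (Suc n))"
proof -
  obtain w where w: "\<And>n. w n \<in> I" "\<And>n. 1 \<le> n \<Longrightarrow> x \<in> word_map f w n ` X"
    using x by (auto simp: limit_set_def)
  have mX: "word_map f w n ` X \<subseteq> X" for n
    by (induction n) (use self w(1) in \<open>auto simp: image_subset_iff\<close>)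
  have minj: "inj_on (word_map f w n) X" for n
  proof (induction n)
    case (Suc n)
    have "inj_on (word_map f w n) (f (w n) ` X)"
      using Suc.IH self[OF w(1)[of n]] by (rule inj_on_subset)
    with inj[OF w(1)[of n]] show ?case
      unfolding word_map.simps by (rule comp_inj_on)
  qed auto
  \<comment> \<open>The intersection in \<open>limit_set\<close> starts at n = 1, so level 0 has to
    be recovered from level 1.\<close>
  have "x \<in> word_map f w n ` X" for n
    using w(2)[of n] w(2)[of 1] mX[of 1] by (cases n) auto
  then obtain z where z: "\<And>n. z n \<in> X" "\<And>n. word_map f w n (z n) = x"
    unfolding image_iff by metis
  have zS: "z n = f (w n) (z (Suc n))" for n
    by (rule inj_onD[OF minj[of n]])
       (use z(2)[of "Suc n"] z(2)[of n] z(1) self[OF w(1)[of n]] in auto)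
  show ?thesis by (rule that[OF w(1) z zS])
qed

lemma word_map_eq_foldr: "word_map f w n = foldr f (map w [0..<n])"
  by (induction n) (auto simp: fun_eq_iff)

section \<open>Geometry of the disc and of the maps 1 / (z + b)\<close>

lemma mem_gccf_spaceD:
  assumes "z \<in> gccf_space"
  shows "0 \<le> Re z" "- 1 / 2 \<le> Im z" "Re z \<le> 1" "Im z \<le> 1 / 2"
  using abs_Re_le_cmod[of "z - 1/2"] abs_Im_le_cmod[of "z - 1/2"] assms
  by (auto simp: gccf_space_def abs_le_iff)

lemma gccf_space_dist_le: "x \<in> gccf_space \<Longrightarrow> y \<in> gccf_space \<Longrightarrow> cmod (x - y) \<le> 1"
  using norm_triangle_ineq4[of "x - 1/2" "y - 1/2"] by (auto simp: gccf_space_def)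

lemma zero_in_gccf_space: "0 \<in> gccf_space" and one_in_gccf_space: "1 \<in> gccf_space"
  by (simp_all add: gccf_space_def norm_divide)

lemma compact_gccf_space: "compact gccf_space"
proof -
  have "gccf_space = cball (1/2) (1/2)"
    by (auto simp: gccf_space_def dist_norm norm_minus_commute)
  then show ?thesis by (metis compact_cball)
qed

text \<open>Inversion carries the half-plane Re w \<ge> 1 into the disc: the disc condition on 1 / w
  reads \<open>cmod (2 - w) \<le> cmod w\<close>, that is, w is no closer to 0 than to 2.\<close>

lemma inverse_in_gccf_space:
  assumes "1 \<le> Re w"
  shows "1 / w \<in> gccf_space"
proof -
  have w: "w \<noteq> 0" using assms by auto
  have "1 / w - 1 / 2 = (2 - w) / (2 * w)" using w by (simp add: field_simps)
  moreover have "(cmod (2 - w))\<^sup>2 \<le> (cmod w)\<^sup>2"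
    using assms unfolding cmod_power2 by (simp add: power2_eq_square algebra_simps)
  then have "cmod (2 - w) \<le> cmod w" by (rule power2_le_imp_le) simp
  ultimately show ?thesis using w by (simp add: gccf_space_def norm_divide norm_mult)
qed

lemma gccf_map_in_space: "1 \<le> Re b \<Longrightarrow> z \<in> gccf_space \<Longrightarrow> gccf_map b z \<in> gccf_space"
  unfolding gccf_map_def using mem_gccf_spaceD(1)[of z] by (intro inverse_in_gccf_space) simp

lemma shift_nonzero: "1 \<le> Re p \<Longrightarrow> z \<in> gccf_space \<Longrightarrow> z + p \<noteq> 0"
  using mem_gccf_spaceD(1)[of z] by (auto simp: complex_eq_iff)

text \<open>The disc has diameter 1, and \<open>y + p\<close> has modulus at least 1, so moving from
  y to x at most doubles the modulus.\<close>

lemma shift_distortion: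
  assumes "1 \<le> Re p" "x \<in> gccf_space" "y \<in> gccf_space"
  shows "cmod (x + p) \<le> 2 * cmod (y + p)"
proof -
  have "cmod (x + p) \<le> cmod (x - y) + cmod (y + p)"
    using norm_triangle_ineq[of "x - y" "y + p"] by simp
  moreover have "1 \<le> cmod (y + p)"
    using complex_Re_le_cmod[of "y + p"] mem_gccf_spaceD(1)[OF assms(3)] assms(1) by simp
  ultimately show ?thesis using gccf_space_dist_le[OF assms(2,3)] by linarith
qed

lemma gccf_map_dist:
  assumes "1 \<le> Re b" "1 \<le> Re c" "x \<in> gccf_space" "y \<in> gccf_space"
  shows "cmod (gccf_map b x - gccf_map c y) = cmod ((x - y) + (b - c)) / (cmod (x + b) * cmod (y + c))"
proof -
  have "gccf_map b x - gccf_map c y = - ((x - y) + (b - c)) / ((x + b) * (y + c))"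
    using shift_nonzero[of b x] shift_nonzero[of c y] assms by (simp add: gccf_map_def field_simps)
  then show ?thesis by (simp add: norm_divide norm_mult del: minus_add_distrib)
qed

lemma foldr_gccf_map_in_space:
  "(\<And>b. b \<in> set u \<Longrightarrow> 1 \<le> Re b) \<Longrightarrow> z \<in> gccf_space \<Longrightarrow> foldr gccf_map u z \<in> gccf_space"
  by (induction u) (auto intro: gccf_map_in_space)

text \<open>
  The derivative of \<open>foldr gccf_map u\<close> at \<open>z\<close> has modulus \<open>1 / (C * (cmod (z + p))\<^sup>2)\<close>: the pole \<open>- p\<close> is the
  reversed continued fraction, so it stays at distance at least 1 from the space.
\<close>

lemma foldr_gccf_map_dist:
  assumes "u \<noteq> []" "\<And>b. b \<in> set u \<Longrightarrow> 1 \<le> Re b"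
  shows "\<exists>C p. 0 < C \<and> 1 \<le> Re p \<and> (\<forall>x\<in>gccf_space. \<forall>y\<in>gccf_space.
    cmod (foldr gccf_map u x - foldr gccf_map u y) = cmod (x - y) / (C * cmod (x + p) * cmod (y + p)))"
  using assms
proof (induction u rule: rev_induct)
  case (snoc b u)
  have b: "1 \<le> Re b" using snoc.prems by auto
  show ?case
  proof (cases "u = []")
    case True
    then show ?thesis using b by (intro exI[of _ 1] exI[of _ b]) (auto simp: gccf_map_dist)
  next
    case False
    then obtain C p where C: "0 < C" and p: "1 \<le> Re p"
      and eq: "\<And>x y. x \<in> gccf_space \<Longrightarrow> y \<in> gccf_space \<Longrightarrow>
        cmod (foldr gccf_map u x - foldr gccf_map u y) = cmod (x - y) / (C * cmod (x + p) * cmod (y + p))"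
      using snoc by auto
    \<comment> \<open>The pole of the longer composition: \<open>gccf_map b x = - p\<close> exactly
      when \<open>x = - p'\<close>.\<close>
    define p' where "p' = b + 1 / p"
    have p0: "p \<noteq> 0" using p by auto
    have "0 \<le> Re (1 / p)" using mem_gccf_spaceD(1)[OF inverse_in_gccf_space[OF p]] .
    then have p': "1 \<le> Re p'" using b unfolding p'_def by simp
    have sh: "cmod (gccf_map b x + p) = cmod p * cmod (x + p') / cmod (x + b)" if "x \<in> gccf_space" for x
    proof -
      have "gccf_map b x + p = p * (x + p') / (x + b)"
      proof -
        have "p * (x + p') = 1 + p * (x + b)" using p0 by (simp add: p'_def distrib_left)
        then show ?thesis
          using shift_nonzero[OF b that] by (simp add: gccf_map_def add_divide_distrib)
      qed
      then show ?thesis by (simp add: norm_mult norm_divide)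
    qed
    have "cmod (foldr gccf_map (u @ [b]) x - foldr gccf_map (u @ [b]) y) =
        cmod (x - y) / (C * (cmod p)\<^sup>2 * cmod (x + p') * cmod (y + p'))"
      if xy: "x \<in> gccf_space" "y \<in> gccf_space" for x y
    proof -
      have nz: "cmod (x + b) \<noteq> 0" "cmod (y + b) \<noteq> 0" "cmod (x + p') \<noteq> 0" "cmod (y + p') \<noteq> 0"
        using shift_nonzero b p' xy by auto
      have "cmod (foldr gccf_map (u @ [b]) x - foldr gccf_map (u @ [b]) y) =
          cmod (gccf_map b x - gccf_map b y) / (C * cmod (gccf_map b x + p) * cmod (gccf_map b y + p))"
        using xy b by (simp add: eq gccf_map_in_space)
      also have "\<dots> = cmod (x - y) / (C * (cmod p)\<^sup>2 * cmod (x + p') * cmod (y + p'))"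
      proof -
        have "\<beta> \<noteq> 0 \<Longrightarrow> \<gamma> \<noteq> 0 \<Longrightarrow>
          \<alpha> / (\<beta> * \<gamma>) / (C * (P * \<mu> / \<beta>) * (P * \<nu> / \<gamma>)) = \<alpha> / (C * P\<^sup>2 * \<mu> * \<nu>)"
          for \<alpha> \<beta> \<gamma> \<mu> \<nu> P :: real
          by (simp add: power2_eq_square mult_ac)
        from this[OF nz(1,2)] show ?thesis
          unfolding sh[OF xy(1)] sh[OF xy(2)] gccf_map_dist[OF b b xy] by simp
      qed
      finally show ?thesis .
    qed
    then show ?thesis using C p' p0 by (intro exI[of _ "C * (cmod p)\<^sup>2"] exI[of _ p']) auto
  qed
qed auto

text \<open>Here l is the modulus of the derivative at 0. Both \<open>cmod (x + p)\<close> and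
  \<open>cmod (y + p)\<close> are within a factor 2 of \<open>cmod p\<close>, hence the constant 4,
  the same for all words.\<close>

lemma foldr_gccf_map_distortion:
  assumes "\<And>b. b \<in> set u \<Longrightarrow> 1 \<le> Re b"
  shows "\<exists>l>0. \<forall>x\<in>gccf_space. \<forall>y\<in>gccf_space.
    l / 4 * cmod (x - y) \<le> cmod (foldr gccf_map u x - foldr gccf_map u y) \<and>
    cmod (foldr gccf_map u x - foldr gccf_map u y) \<le> 4 * l * cmod (x - y)"
proof (cases "u = []")
  case True
  then show ?thesis by (intro exI[of _ 1]) auto
next
  case False
  then obtain C p where C: "0 < C" and p: "1 \<le> Re p"
    and eq: "\<And>x y. x \<in> gccf_space \<Longrightarrow> y \<in> gccf_space \<Longrightarrow>
      cmod (foldr gccf_map u x - foldr gccf_map u y) = cmod (x - y) / (C * cmod (x + p) * cmod (y + p))"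
    using foldr_gccf_map_dist assms by meson
  have p0: "p \<noteq> 0" using p by auto
  have b: "cmod (x + p) \<le> 2 * cmod p" "cmod p / 2 \<le> cmod (x + p)" if "x \<in> gccf_space" for x
    using shift_distortion[OF p that zero_in_gccf_space] shift_distortion[OF p zero_in_gccf_space that] by auto
  define l where "l = 1 / (C * (cmod p)\<^sup>2)"
  have l: "0 < l" using C p0 by (simp add: l_def)
  have "l / 4 * cmod (x - y) \<le> cmod (foldr gccf_map u x - foldr gccf_map u y) \<and>
      cmod (foldr gccf_map u x - foldr gccf_map u y) \<le> 4 * l * cmod (x - y)"
    if xy: "x \<in> gccf_space" "y \<in> gccf_space" for x y
  proof
    have pos: "0 < cmod (x + p)" "0 < cmod (y + p)" using shift_nonzero p xy by auto
    have "C * cmod (x + p) * cmod (y + p) \<le> C * (2 * cmod p) * (2 * cmod p)"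
      using b xy C by (intro mult_mono) auto
    then have "cmod (x - y) / (C * (2 * cmod p) * (2 * cmod p)) \<le> cmod (x - y) / (C * cmod (x + p) * cmod (y + p))"
      using C pos p0 by (intro divide_left_mono) auto
    moreover have "l / 4 * cmod (x - y) = cmod (x - y) / (C * (2 * cmod p) * (2 * cmod p))"
      by (simp add: l_def power2_eq_square mult_ac)
    ultimately show "l / 4 * cmod (x - y) \<le> cmod (foldr gccf_map u x - foldr gccf_map u y)"
      using xy by (simp add: eq)
    have "C * (cmod p / 2) * (cmod p / 2) \<le> C * cmod (x + p) * cmod (y + p)"
      using b xy C by (intro mult_mono) auto
    then have "cmod (x - y) / (C * cmod (x + p) * cmod (y + p)) \<le> cmod (x - y) / (C * (cmod p / 2) * (cmod p / 2))"
      using C pos p0 by (intro divide_left_mono) auto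
    moreover have "4 * l * cmod (x - y) = cmod (x - y) / (C * (cmod p / 2) * (cmod p / 2))"
      by (simp add: l_def power2_eq_square mult_ac)
    ultimately show "cmod (foldr gccf_map u x - foldr gccf_map u y) \<le> 4 * l * cmod (x - y)"
      using xy by (simp add: eq)
  qed
  with l show ?thesis by blast
qed

lemma gccf_index_ge:
  assumes "\<tau> \<in> gccf_params" "b \<in> gccf_index \<tau>"
  shows "1 \<le> Re b" "1 \<le> Im b"
proof -
  obtain m n :: nat where b: "b = of_nat m + of_nat n * \<tau>" "1 \<le> m" "1 \<le> n"
    using assms(2) by (auto simp: gccf_index_def)
  have "1 * 1 \<le> real n * Im \<tau>" "0 \<le> real n * Re \<tau>"
    using b(2,3) assms(1) by (intro mult_mono mult_nonneg_nonneg, auto simp: gccf_params_def)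
  then show "1 \<le> Re b" "1 \<le> Im b" using b by auto
qed

text \<open>Real parts alone give only \<open>1 \<le> cmod (z + w n)\<close>. The imaginary part of
  \<open>z + w n\<close> is at least 1/2, so the squared modulus is at least 5/4 > (11/10)^2, which
  makes the contraction uniform.\<close>

lemma word_map_gccf_dist_le:
  assumes "\<And>n. 1 \<le> Re (w n)" "\<And>n. 1 \<le> Im (w n)" "x \<in> gccf_space" "y \<in> gccf_space"
  shows "cmod (word_map gccf_map w n x - word_map gccf_map w n y) \<le> (10/11) ^ n * cmod (x - y)"
  using assms(3,4)
proof (induction n arbitrary: x y)
  case (Suc n)
  have ge: "11/10 \<le> cmod (z + w n)" if "z \<in> gccf_space" for z
  proof -
    have "1 \<le> Re (z + w n)" "1/2 \<le> Im (z + w n)"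
      using mem_gccf_spaceD[OF that] assms(1,2)[of n] by auto
    then have "1\<^sup>2 + (1/2)\<^sup>2 \<le> (Re (z + w n))\<^sup>2 + (Im (z + w n))\<^sup>2"
      by (intro add_mono power_mono) auto
    then have "(11/10)\<^sup>2 \<le> (cmod (z + w n))\<^sup>2" unfolding cmod_power2 by (simp add: power2_eq_square)
    then show ?thesis by (rule power2_le_imp_le) simp
  qed
  have "11/10 * 1 \<le> cmod (x + w n) * cmod (y + w n)"
    using ge[OF Suc.prems(1)] ge[OF Suc.prems(2)] by (intro mult_mono) auto
  then have "cmod (x - y) / (cmod (x + w n) * cmod (y + w n)) \<le> cmod (x - y) / (11/10)"
    by (intro divide_left_mono) auto
  then have "cmod (gccf_map (w n) x - gccf_map (w n) y) \<le> 10/11 * cmod (x - y)"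
    using Suc.prems assms(1) by (simp add: gccf_map_dist)
  then have "(10/11) ^ n * cmod (gccf_map (w n) x - gccf_map (w n) y) \<le> (10/11) ^ n * (10/11 * cmod (x - y))"
    by (intro mult_left_mono) auto
  moreover have "cmod (word_map gccf_map w (Suc n) x - word_map gccf_map w (Suc n) y)
      \<le> (10/11) ^ n * cmod (gccf_map (w n) x - gccf_map (w n) y)"
    using Suc.IH Suc.prems assms(1) by (simp add: gccf_map_in_space)
  ultimately have "cmod (word_map gccf_map w (Suc n) x - word_map gccf_map w (Suc n) y)
      \<le> (10/11) ^ n * (10/11 * cmod (x - y))"
    by (rule order_trans[rotated])
  also have "\<dots> = (10/11) ^ Suc n * cmod (x - y)" by simp
  finally show ?case .
qed simp

section \<open>Cylinders inside balls\<close>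

text \<open>
  Only every second lattice point is used: the translates of the space by neighbouring lattice
  points may be tangent, whereas the finite subsystems need disjoint images.
\<close>

lemma gccf_grid:
  fixes N :: nat
  assumes \<tau>: "\<tau> \<in> gccf_params" and a: "a \<in> gccf_index \<tau>"
  defines "B \<equiv> (\<lambda>(m, n). a + of_nat (2 * m) + of_nat (2 * n) * \<tau>) ` ({..<N} \<times> {..<N})"
  shows "finite B" "card B = N * N" "B \<subseteq> gccf_index \<tau>"
    and "\<And>b c. b \<in> B \<Longrightarrow> c \<in> B \<Longrightarrow> b \<noteq> c \<Longrightarrow> 2 \<le> cmod (b - c)"
    and "\<And>b. b \<in> B \<Longrightarrow> cmod (b - a) \<le> 2 * N * (1 + cmod \<tau>)"
    and "\<And>b. b \<in> B \<Longrightarrow> cmod a \<le> cmod b"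
proof -
  have re: "0 \<le> Re \<tau>" and im: "1 \<le> Im \<tau>" using \<tau> by (auto simp: gccf_params_def)
  let ?f = "\<lambda>(m, n). a + of_nat (2 * m) + of_nat (2 * n) * \<tau>"
  have sep: "2 \<le> cmod (?f p - ?f q)" if "p \<noteq> q" for p q :: "nat \<times> nat"
  proof -
    obtain m n m' n' where pq: "p = (m, n)" "q = (m', n')" by fastforce
    define d where "d = ?f p - ?f q"
    have "2 \<le> cmod d"
    proof (cases "n = n'")
      case True
      define e where "e = real m - real m'"
      have "Re d = 2 * e" using True by (simp add: pq d_def e_def)
      moreover have "1 \<le> \<bar>e\<bar>" using True that pq by (auto simp: e_def)
      moreover have "\<bar>Re d\<bar> \<le> cmod d" by (rule abs_Re_le_cmod)
      ultimately show ?thesis by simp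
    next
      case False
      define e where "e = real n - real n'"
      have "Im d = 2 * (e * Im \<tau>)" by (simp add: pq d_def e_def algebra_simps)
      then have "\<bar>Im d\<bar> = 2 * (\<bar>e\<bar> * Im \<tau>)" using im by (simp add: abs_mult)
      moreover have "1 * 1 \<le> \<bar>e\<bar> * Im \<tau>" using False im by (intro mult_mono) (auto simp: e_def)
      moreover have "\<bar>Im d\<bar> \<le> cmod d" by (rule abs_Im_le_cmod)
      ultimately show ?thesis by simp
    qed
    then show ?thesis by (simp add: d_def)
  qed
  show "finite B" by (simp add: B_def)
  have "inj_on ?f ({..<N} \<times> {..<N})"
  proof (rule inj_onI, rule ccontr)
    fix p q assume "?f p = ?f q" "p \<noteq> q"
    with sep[of p q] show False by (simp only: right_minus_eq norm_zero) simp
  qed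
  then show "card B = N * N" by (simp add: B_def card_image card_cartesian_product)
  show "2 \<le> cmod (b - c)" if bc: "b \<in> B" "c \<in> B" "b \<noteq> c" for b c
  proof -
    obtain p q where pq: "b = ?f p" "c = ?f q" using bc unfolding B_def by blast
    then have "p \<noteq> q" using bc by blast
    then show ?thesis unfolding pq by (rule sep)
  qed
  obtain k l :: nat where kl: "a = of_nat k + of_nat l * \<tau>" "1 \<le> k" "1 \<le> l"
    using a by (auto simp: gccf_index_def)
  show "B \<subseteq> gccf_index \<tau>"
  proof
    fix b assume "b \<in> B"
    then obtain m n where b: "b = a + of_nat (2 * m) + of_nat (2 * n) * \<tau>" by (auto simp: B_def)
    have "b = of_nat (k + 2 * m) + of_nat (l + 2 * n) * \<tau>" unfolding b kl by (simp add: algebra_simps)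
    moreover have "1 \<le> k + 2 * m" "1 \<le> l + 2 * n" using kl by auto
    ultimately show "b \<in> gccf_index \<tau>" unfolding gccf_index_def by blast
  qed
  fix b assume "b \<in> B"
  then obtain m n where b: "b = a + of_nat (2 * m) + of_nat (2 * n) * \<tau>" and mn: "m < N" "n < N"
    by (auto simp: B_def)
  have "b - a = of_nat (2 * m) + of_nat (2 * n) * \<tau>" by (simp add: b)
  then have "cmod (b - a) \<le> cmod (of_nat (2 * m)) + cmod (of_nat (2 * n) * \<tau>)"
    by (simp only: norm_triangle_ineq)
  also have "\<dots> = 2 * real m + 2 * real n * cmod \<tau>"
    by (simp only: norm_mult norm_of_nat)
  also have "\<dots> \<le> 2 * real N + 2 * real N * cmod \<tau>"
    using mn by (intro add_mono mult_mono) auto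
  finally show "cmod (b - a) \<le> 2 * N * (1 + cmod \<tau>)" by (simp add: algebra_simps)
  \<comment> \<open>The letter \<open>a\<close> and both lattice directions lie in the closed first
    quadrant, so moving along the grid cannot decrease the modulus.\<close>
  have "Re a \<le> Re b" "Im a \<le> Im b" using re im by (simp_all add: b)
  then have "(Re a)\<^sup>2 + (Im a)\<^sup>2 \<le> (Re b)\<^sup>2 + (Im b)\<^sup>2"
    using gccf_index_ge[OF \<tau> a] by (intro add_mono power_mono) auto
  then show "cmod a \<le> cmod b" by (simp add: cmod_def)
qed

text \<open>
  All letters of \<open>B\<close> have modulus at most \<open>\<beta>\<close>, so their images have diameter of order \<open>1 / \<beta>\<^sup>2\<close> at least,
  and the last inequality says that together they fill a fixed proportion of a ball of radius \<open>\<rho>\<close>.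
  If \<open>\<rho>\<close> is large against \<open>1 / cmod b\<close>, the ball contains a neighbourhood of 0, hence the images of all
  letters of modulus of order \<open>1 / \<rho>\<close>; between \<open>1 / (cmod b)\<^sup>2\<close> and \<open>1 / cmod b\<close>, it contains the images of
  the letters near \<open>b\<close>; below that, \<open>b\<close> alone is enough, and then its image need not lie in the ball.
\<close>

lemma gccf_letters_near:
  assumes \<tau>: "\<tau> \<in> gccf_params" and b: "b \<in> gccf_index \<tau>" and y: "y \<in> gccf_space"
    and \<rho>: "0 < \<rho>" "\<rho> \<le> 1"
  shows "\<exists>B \<beta> N. finite B \<and> card B = N * N \<and> 1 \<le> N \<and> B \<subseteq> gccf_index \<tau> \<and>
    (\<forall>c\<in>B. \<forall>c'\<in>B. c \<noteq> c' \<longrightarrow> 2 \<le> cmod (c - c')) \<and> 0 < \<beta> \<and>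
    (\<forall>c\<in>B. cmod c \<le> \<beta> \<and> (c = b \<or> gccf_map c ` gccf_space \<subseteq> cball (gccf_map b y) \<rho>)) \<and>
    \<rho> * \<beta>\<^sup>2 \<le> 216 * (1 + cmod \<tau>)\<^sup>2 * real N"
proof -
  define T where "T = 1 + cmod \<tau>"
  have T: "1 \<le> T" by (simp add: T_def)
  then have TT: "T \<le> T\<^sup>2" by (simp add: power2_eq_square)
  note ge = gccf_index_ge[OF \<tau>]
  have low: "cmod c / 2 \<le> cmod (z + c)" if "c \<in> gccf_index \<tau>" "z \<in> gccf_space" for c z
    using shift_distortion[OF ge(1)[OF that(1)] zero_in_gccf_space that(2)] by simp
  have pos: "0 < cmod c" if "c \<in> gccf_index \<tau>" for c using ge(1)[OF that] by auto
  have norm_map: "cmod (gccf_map c z) \<le> 2 / cmod c" if "c \<in> gccf_index \<tau>" "z \<in> gccf_space" for c z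
  proof -
    have "1 / cmod (z + c) \<le> 1 / (cmod c / 2)"
      using low[OF that] pos[OF that(1)] by (intro divide_left_mono mult_pos_pos) auto
    then show ?thesis by (simp add: gccf_map_def norm_divide)
  qed
  consider (far) "8 \<le> \<rho> * cmod b" | (near) "\<rho> * cmod b < 8" "12 * T \<le> \<rho> * (cmod b)\<^sup>2"
    | (single) "\<rho> * (cmod b)\<^sup>2 < 12 * T" by linarith
  then show ?thesis
  proof cases
    case far
    \<comment> \<open>The corner letter \<open>a\<close> below has modulus at least 2N \<ge> 4 /
      \<rho>, which puts all images of the grid within \<rho> / 2 of 0; \<open>far\<close> does the
      same for \<open>gccf_map b y\<close>. The bound N \<le> 3 / \<rho> yields the modulus bound
      12T / \<rho>.\<close>
    define N where "N = nat \<lceil>2 / \<rho>\<rceil>"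
    have "2 / \<rho> \<le> real N" "real N \<le> 2 / \<rho> + 1"
      using \<rho> by (auto simp: N_def of_nat_nat)
    moreover have "1 \<le> 1 / \<rho>" using \<rho> by simp
    ultimately have N: "2 / \<rho> \<le> real N" "real N \<le> 3 / \<rho>" and N1: "1 \<le> N" by linarith+
    define a where "a = of_nat (2 * N) + of_nat (2 * N) * \<tau>"
    have a: "a \<in> gccf_index \<tau>" unfolding gccf_index_def a_def using N1 by fastforce
    define B where "B = (\<lambda>(m, n). a + of_nat (2 * m) + of_nat (2 * n) * \<tau>) ` ({..<N} \<times> {..<N})"
    note B = gccf_grid[OF \<tau> a, where N = N, folded B_def]
    have na: "cmod a \<le> 2 * N * T"
    proof -
      have "a = of_nat (2 * N) * (1 + \<tau>)" by (simp add: a_def algebra_simps)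
      then have "cmod a = 2 * N * cmod (1 + \<tau>)" by (simp only: norm_mult norm_of_nat)
      also have "\<dots> \<le> 2 * N * T"
        using norm_triangle_ineq[of 1 \<tau>] by (intro mult_left_mono) (auto simp: T_def)
      finally show ?thesis .
    qed
    have an: "2 * N \<le> cmod a"
    proof -
      have "2 * N \<le> Re a" using \<tau> by (simp add: a_def gccf_params_def)
      then show ?thesis using complex_Re_le_cmod[of a] by linarith
    qed
    have le: "cmod c \<le> 12 * T / \<rho>" if "c \<in> B" for c
    proof -
      have "cmod c \<le> cmod (c - a) + cmod a" using norm_triangle_ineq[of "c - a" a] by simp
      also have "\<dots> \<le> 4 * T * N" using na B(5)[OF that] by (simp add: T_def algebra_simps)
      also have "\<dots> \<le> 4 * T * (3 / \<rho>)" using N T by (intro mult_left_mono) auto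
      finally show ?thesis by simp
    qed
    have img: "gccf_map c z \<in> cball (gccf_map b y) \<rho>" if c: "c \<in> B" and z: "z \<in> gccf_space" for c z
    proof -
      have cI: "c \<in> gccf_index \<tau>" using c B(3) by blast
      have "4 / \<rho> \<le> cmod c" using B(6)[OF c] an N by simp
      then have "2 / cmod c \<le> \<rho> / 2" using pos[OF cI] \<rho> by (simp add: field_simps)
      moreover have "2 / cmod b \<le> \<rho> / 2" using far pos[OF b] by (simp add: field_simps)
      ultimately have "cmod (gccf_map b y) + cmod (gccf_map c z) \<le> \<rho>"
        using norm_map[OF cI z] norm_map[OF b y] by linarith
      then show ?thesis using norm_triangle_ineq4[of "gccf_map b y" "gccf_map c z"] by (simp add: dist_norm)
    qed
    have "\<rho> * (12 * T / \<rho>)\<^sup>2 = 72 * T\<^sup>2 * (2 / \<rho>)" using \<rho> by (simp add: power2_eq_square)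
    also have "\<dots> \<le> 72 * T\<^sup>2 * N" using N by (intro mult_left_mono) auto
    also have "\<dots> \<le> 216 * T\<^sup>2 * N" by (intro mult_right_mono) auto
    finally show ?thesis
      using B N1 le img T \<rho> unfolding T_def[symmetric]
      by (intro exI[of _ B] exI[of _ "12 * T / \<rho>"] exI[of _ N]) auto
  next
    case near
    \<comment> \<open>Images under a grid letter and under b differ by at most (1 + 2TN) / (|b| /
      2)^2 \<le> 12TN / |b|^2, which is at most \<rho> as soon as N \<le> q.\<close>
    define q where "q = \<rho> * (cmod b)\<^sup>2 / (12 * T)"
    have q: "1 \<le> q" using near T by (simp add: q_def)
    define N where "N = nat \<lfloor>q\<rfloor>"
    have fl: "real N = of_int \<lfloor>q\<rfloor>" "1 \<le> \<lfloor>q\<rfloor>" using q by (simp_all add: N_def le_floor_iff)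
    then have N: "real N \<le> q" "q \<le> 2 * N" and N1: "1 \<le> N" by linarith+
    have qT: "12 * (T * q) = \<rho> * (cmod b)\<^sup>2" using T by (simp add: q_def)
    have NT: "T * N \<le> T * q" using N T by (intro mult_left_mono) auto
    define B where "B = (\<lambda>(m, n). b + of_nat (2 * m) + of_nat (2 * n) * \<tau>) ` ({..<N} \<times> {..<N})"
    note B = gccf_grid[OF \<tau> b, where N = N, folded B_def]
    have dist_b: "cmod (c - b) \<le> 2 * (T * N)" if "c \<in> B" for c
      using B(5)[OF that] by (simp add: T_def mult_ac)
    \<comment> \<open>The upper limit of this case keeps the grid at the scale of b: its letters are
      at distance at most 2TN \<le> \<rho> |b|^2 / 6 \<le> 8 |b| / 6 from b.\<close>
    have "\<rho> * (cmod b)\<^sup>2 \<le> 8 * cmod b"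
      using near(1) pos[OF b] by (simp add: power2_eq_square mult.assoc[symmetric])
    then have le: "cmod c \<le> 3 * cmod b" if "c \<in> B" for c
      using dist_b[OF that] NT qT norm_triangle_ineq[of "c - b" b] norm_ge_zero[of b]
      by (simp only: diff_add_cancel)
    have img: "gccf_map c z \<in> cball (gccf_map b y) \<rho>" if c: "c \<in> B" and z: "z \<in> gccf_space" for c z
    proof -
      have cI: "c \<in> gccf_index \<tau>" using c B(3) by blast
      have TN: "1 \<le> T * N" using T N1 by (metis mult_mono' mult_1 of_nat_1 of_nat_le_iff zero_le_one)
      have "cmod ((z - y) + (c - b)) \<le> 3 * (T * N)"
        using norm_triangle_ineq[of "z - y" "c - b"] gccf_space_dist_le[OF z y] dist_b[OF c] TN by linarith
      also have "\<dots> \<le> \<rho> * (cmod b / 2 * (cmod b / 2))" using NT qT by (simp add: power2_eq_square)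
      also have "\<dots> \<le> \<rho> * (cmod (z + c) * cmod (y + b))"
        using low[OF cI z] low[OF b y] B(6)[OF c] \<rho> pos[OF b] by (intro mult_left_mono mult_mono) auto
      finally have "cmod (gccf_map c z - gccf_map b y) \<le> \<rho>"
        using shift_nonzero[OF ge(1)[OF cI] z] shift_nonzero[OF ge(1)[OF b] y]
        by (simp add: gccf_map_dist ge(1) cI b y z divide_le_eq zero_less_mult_iff)
      then show ?thesis by (simp add: dist_norm norm_minus_commute)
    qed
    \<comment> \<open>This case dictates the constant: 9 * 12 = 108, doubled to 216 by q \<le>
      2N.\<close>
    have "\<rho> * (3 * cmod b)\<^sup>2 = 108 * (T * q)" using qT by (simp add: power2_eq_square)
    also have "\<dots> \<le> 108 * (T\<^sup>2 * (2 * N))" using TT N q by (intro mult_left_mono mult_mono) auto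
    finally have "\<rho> * (3 * cmod b)\<^sup>2 \<le> 216 * T\<^sup>2 * N" by simp
    then show ?thesis
      using B N1 le img pos[OF b] unfolding T_def[symmetric]
      by (intro exI[of _ B] exI[of _ "3 * cmod b"] exI[of _ N]) auto
  next
    case single
    then have "\<rho> * (cmod b)\<^sup>2 \<le> 216 * T\<^sup>2 * 1" using TT T by linarith
    then show ?thesis
      using b pos[OF b] unfolding T_def[symmetric]
      by (intro exI[of _ "{b}"] exI[of _ "cmod b"] exI[of _ 1]) auto
  qed
qed

lemma foldr_append_gccf_map_in_cball:
  assumes l: "0 < l" and sp: "z \<in> gccf_space" "y \<in> gccf_space"
    and up: "\<And>x y. x \<in> gccf_space \<Longrightarrow> y \<in> gccf_space \<Longrightarrow>
       cmod (foldr gccf_map u x - foldr gccf_map u y) \<le> 4 * l * cmod (x - y)"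
    and c: "1 \<le> Re c" "1 \<le> Re b" and d: "gccf_map c z \<in> cball (gccf_map b y) \<rho>"
  shows "foldr gccf_map (u @ [c]) z \<in> cball (foldr gccf_map u (gccf_map b y)) (4 * l * \<rho>)"
proof -
  have "cmod (foldr gccf_map u (gccf_map b y) - foldr gccf_map u (gccf_map c z))
      \<le> 4 * l * cmod (gccf_map b y - gccf_map c z)"
    using sp c by (intro up gccf_map_in_space)
  also have "\<dots> \<le> 4 * l * \<rho>" using d l by (intro mult_left_mono) (auto simp: dist_norm)
  finally show ?thesis by (simp add: dist_norm)
qed

text \<open>One lower ratio c serves all words, so that the sum of h-th powers is
  \<open>card W * c powr h\<close>. Disjointness is asked of the closed images, boundaries included,
  because compactness then yields a positive gap.\<close>

definition cylinder_family :: "complex \<Rightarrow> complex list set \<Rightarrow> real \<Rightarrow> complex set \<Rightarrow> bool" where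
  "cylinder_family \<tau> W c S \<longleftrightarrow> finite W \<and> 0 < c \<and>
     (\<forall>u\<in>W. u \<noteq> [] \<and> set u \<subseteq> gccf_index \<tau> \<and> foldr gccf_map u ` gccf_space \<subseteq> S \<and>
       (\<forall>y\<in>gccf_space. \<forall>z\<in>gccf_space. c * cmod (y - z) \<le> cmod (foldr gccf_map u y - foldr gccf_map u z))) \<and>
     (\<forall>u\<in>W. \<forall>v\<in>W. u \<noteq> v \<longrightarrow> foldr gccf_map u ` gccf_space \<inter> foldr gccf_map v ` gccf_space = {})"

text \<open>Stop at the level k whose cylinder around x leaves the ball while the next one does not.
  The map of the first k letters sends the ball of radius \<rho> = r / (4l) around
  \<open>gccf_map b y\<close>, within the disc, into the given ball. The letter b itself is
  admissible by the choice of k, even if its image exceeds that smaller ball.\<close>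

lemma gccf_local_cylinders:
  assumes \<tau>: "\<tau> \<in> gccf_params" and h: "0 \<le> h" "h \<le> 2"
    and x: "x \<in> gccf_limit_set \<tau>" and r: "0 < r" "r \<le> 1 / 4"
  shows "\<exists>W c. cylinder_family \<tau> W c (cball x r) \<and>
    r powr h \<le> (64 * (216 * (1 + cmod \<tau>)\<^sup>2))\<^sup>2 * (real (card W) * c powr h)"
proof -
  note ge = gccf_index_ge[OF \<tau>]
  have self: "gccf_map b ` gccf_space \<subseteq> gccf_space" if "b \<in> gccf_index \<tau>" for b
    using gccf_map_in_space ge(1)[OF that] by blast
  have inj: "inj_on (gccf_map b) gccf_space" if "b \<in> gccf_index \<tau>" for b
    using ge(1)[OF that] shift_nonzero[of b] by (intro inj_onI) (simp add: gccf_map_def)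
  obtain w z where w: "\<And>n. w n \<in> gccf_index \<tau>" and z: "\<And>n. z n \<in> gccf_space"
      and wz: "\<And>n. word_map gccf_map w n (z n) = x" and zS: "\<And>n. z n = gccf_map (w n) (z (Suc n))"
    using limit_set_orbit[OF x[unfolded gccf_limit_set_def] self inj] by metis
  let ?P = "\<lambda>n. word_map gccf_map w n ` gccf_space \<subseteq> cball x r"
  have "\<exists>n. ?P n"
  proof -
    obtain n where n: "(10/11) ^ n < r" using real_arch_pow_inv[OF r(1), of "10/11"] by auto
    have "dist x (word_map gccf_map w n y) \<le> r" if y: "y \<in> gccf_space" for y
    proof -
      have "dist x (word_map gccf_map w n y) \<le> (10/11) ^ n * cmod (z n - y)"
        using word_map_gccf_dist_le[of w "z n" y n] ge w z y wz[of n] by (simp add: dist_norm)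
      also have "\<dots> \<le> (10/11) ^ n * 1"
        using gccf_space_dist_le[OF z y] by (intro mult_left_mono) auto
      finally show ?thesis using n by simp
    qed
    then show ?thesis by (intro exI[of _ n]) auto
  qed
  then obtain n where n: "?P n" by blast
  \<comment> \<open>The disc contains 0 and 1, too far apart for a ball of radius at most
    1/4.\<close>
  have P0: "\<not> ?P 0"
  proof
    assume "?P 0"
    then have "dist x 0 \<le> r" "dist x 1 \<le> r" using zero_in_gccf_space one_in_gccf_space by auto
    moreover have "dist (0::complex) 1 \<le> dist x 0 + dist x 1" by (rule dist_triangle3)
    ultimately show False using r by simp
  qed
  obtain k where k: "\<not> ?P k" "?P (Suc k)"
    using ex_least_nat_less[of ?P, OF n P0] by blast
  define u where "u = map w [0..<k]"
  define b where "b = w k"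
  define y where "y = z (Suc k)"
  have b: "b \<in> gccf_index \<tau>" and y: "y \<in> gccf_space" by (simp_all add: b_def y_def w z)
  have uI: "set u \<subseteq> gccf_index \<tau>" using w by (auto simp: u_def)
  have u1: "1 \<le> Re c" if "c \<in> set u" for c using that uI ge(1) by blast
  have fu: "word_map gccf_map w k = foldr gccf_map u" by (simp add: u_def word_map_eq_foldr)
  have fub: "word_map gccf_map w (Suc k) = foldr gccf_map (u @ [b])"
    using fu by (simp add: b_def fun_eq_iff)
  have xu: "foldr gccf_map u (gccf_map b y) = x"
    using wz[of k] zS[of k] by (simp add: fu b_def y_def)
  obtain l where l: "0 < l"
    and lo: "\<And>x y. x \<in> gccf_space \<Longrightarrow> y \<in> gccf_space \<Longrightarrow>
       l / 4 * cmod (x - y) \<le> cmod (foldr gccf_map u x - foldr gccf_map u y)"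
    and up: "\<And>x y. x \<in> gccf_space \<Longrightarrow> y \<in> gccf_space \<Longrightarrow>
       cmod (foldr gccf_map u x - foldr gccf_map u y) \<le> 4 * l * cmod (x - y)"
    using foldr_gccf_map_distortion[OF u1] by blast
  define \<rho> where "\<rho> = r / (4 * l)"
  have r\<rho>: "r = 4 * l * \<rho>" using l by (simp add: \<rho>_def)
  have \<rho>: "0 < \<rho>" "\<rho> \<le> 1"
  proof -
    show "0 < \<rho>" using l r by (simp add: \<rho>_def)
    \<comment> \<open>Failure at level k: its cylinder has a point farther than r from x, yet its
      diameter is at most 4l.\<close>
    obtain v where v: "v \<in> gccf_space" "r < dist x (foldr gccf_map u v)"
      using k(1) unfolding fu by (force simp: subset_eq not_le)
    have "dist x (foldr gccf_map u v) \<le> 4 * l * cmod (gccf_map b y - v)"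
      using up[of "gccf_map b y" v] self[OF b] y v by (auto simp: dist_norm xu)
    also have "\<dots> \<le> 4 * l * 1"
      using gccf_space_dist_le[of "gccf_map b y" v] self[OF b] y v l by (intro mult_left_mono) auto
    finally show "\<rho> \<le> 1" using v l by (simp add: \<rho>_def)
  qed
  define K where "K = 216 * (1 + cmod \<tau>)\<^sup>2"
  have K: "1 \<le> K"
  proof -
    have "1 \<le> (1 + cmod \<tau>)\<^sup>2" by (rule one_le_power) simp
    then show ?thesis unfolding K_def by (rule order_trans) simp
  qed
  obtain B \<beta> N where finB: "finite B" and cardB: "card B = N * N" and N: "1 \<le> N"
    and BI: "B \<subseteq> gccf_index \<tau>"
    and sep: "\<forall>c\<in>B. \<forall>c'\<in>B. c \<noteq> c' \<longrightarrow> 2 \<le> cmod (c - c')"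
    and \<beta>: "0 < \<beta>"
    and sub: "\<forall>c\<in>B. cmod c \<le> \<beta> \<and> (c = b \<or> gccf_map c ` gccf_space \<subseteq> cball (gccf_map b y) \<rho>)"
    and \<rho>\<beta>: "\<rho> * \<beta>\<^sup>2 \<le> K * real N"
    using gccf_letters_near[OF \<tau> b y \<rho>, folded K_def] by (elim exE conjE) (rule that; assumption)
  define W where "W = (\<lambda>c. u @ [c]) ` B"
  \<comment> \<open>The factor l / 4 comes from the prefix u, and 1 / (2 \<beta>)^2 from the last
    letter.\<close>
  define c where "c = l / (16 * \<beta>\<^sup>2)"
  have c: "0 < c" using l \<beta> by (simp add: c_def)
  have cardW: "card W = N * N" using cardB by (simp add: W_def card_image inj_on_def)
  have B1: "1 \<le> Re a" if "a \<in> B" for a using that BI ge(1) by blast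
  have img: "foldr gccf_map (u @ [a]) ` gccf_space \<subseteq> cball x r" if a: "a \<in> B" for a
  proof (cases "a = b")
    case True
    then show ?thesis using k(2) by (simp only: fub)
  next
    case False
    then have "gccf_map a v \<in> cball (gccf_map b y) \<rho>" if "v \<in> gccf_space" for v
      using bspec[OF sub a] that by blast
    then have "foldr gccf_map (u @ [a]) v \<in> cball x r" if "v \<in> gccf_space" for v
      using foldr_append_gccf_map_in_cball[OF l that y up B1[OF a] ge(1)[OF b], of \<rho>] that
      by (simp only: xu r\<rho>)
    then show ?thesis by blast
  qed
  have low: "c * cmod (p - q) \<le> cmod (foldr gccf_map (u @ [a]) p - foldr gccf_map (u @ [a]) q)"
    if a: "a \<in> B" and pq: "p \<in> gccf_space" "q \<in> gccf_space" for a p q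
  proof -
    have le: "cmod (v + a) \<le> 2 * \<beta>" if "v \<in> gccf_space" for v
      using shift_distortion[OF B1[OF a] that zero_in_gccf_space] bspec[OF sub a] by simp
    have "c * cmod (p - q) = l / 4 * (cmod (p - q) / (2 * \<beta> * (2 * \<beta>)))"
      by (simp add: c_def power2_eq_square)
    also have "\<dots> \<le> l / 4 * (cmod (p - q) / (cmod (p + a) * cmod (q + a)))"
      using l \<beta> le pq shift_nonzero[OF B1[OF a]]
      by (intro mult_left_mono divide_left_mono mult_mono) auto
    also have "\<dots> = l / 4 * cmod (gccf_map a p - gccf_map a q)"
      using pq by (simp add: gccf_map_dist B1 a)
    also have "\<dots> \<le> cmod (foldr gccf_map (u @ [a]) p - foldr gccf_map (u @ [a]) q)"
      using lo[of "gccf_map a p" "gccf_map a q"] pq gccf_map_in_space[OF B1[OF a]] by simp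
    finally show ?thesis .
  qed
  have disj: "foldr gccf_map (u @ [a]) ` gccf_space \<inter> foldr gccf_map (u @ [a']) ` gccf_space = {}"
    if a: "a \<in> B" "a' \<in> B" "a \<noteq> a'" for a a'
  proof (rule ccontr)
    assume "\<not> ?thesis"
    then obtain p q where pq: "p \<in> gccf_space" "q \<in> gccf_space"
      "foldr gccf_map u (gccf_map a p) = foldr gccf_map u (gccf_map a' q)" by auto
    then have "l / 4 * cmod (gccf_map a p - gccf_map a' q) \<le> 0"
      using lo[of "gccf_map a p" "gccf_map a' q"] gccf_map_in_space B1 a by simp
    then have "gccf_map a p = gccf_map a' q" using l by (simp add: mult_le_0_iff)
    then have "p + a = q + a'"
      using shift_nonzero[OF B1 pq(1)] shift_nonzero[OF B1 pq(2)] a by (simp add: gccf_map_def)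
    \<comment> \<open>Equal images would make two letters differ by a difference of points of the
      disc, so by at most 1, against the spacing 2.\<close>
    then have "a - a' = q - p" by (simp add: algebra_simps)
    then have "cmod (a - a') \<le> 1" using gccf_space_dist_le[OF pq(2,1)] by simp
    then show False using sep a by fastforce
  qed
  \<comment> \<open>The definitions give \<open>r = 64 * (\<rho> * \<beta>\<^sup>2) * c\<close>.
    Raising the exponent of 64KN from h to 2 produces the factor N * N, which is the number of
    words.\<close>
  have "r powr h \<le> (64 * K)\<^sup>2 * (real (card W) * c powr h)"
  proof -
    have KN: "1 \<le> 64 * K * real N" using K N mult_mono[of 1 "64 * K" 1 "real N"] by simp
    have "r = 64 * (\<rho> * \<beta>\<^sup>2) * c" using \<beta> by (simp add: r\<rho> c_def)
    also have "\<dots> \<le> (64 * K * real N) * c" using \<rho>\<beta> c by (intro mult_right_mono) auto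
    finally have "r powr h \<le> ((64 * K * real N) * c) powr h" using r h by (intro powr_mono2) auto
    also have "\<dots> = (64 * K * real N) powr h * c powr h" using KN c by (simp add: powr_mult)
    also have "\<dots> \<le> (64 * K * real N) powr 2 * c powr h"
      using KN h by (intro mult_right_mono powr_mono) auto
    also have "\<dots> = (64 * K)\<^sup>2 * (real (card W) * c powr h)"
      using KN K by (simp add: cardW power2_eq_square)
    finally show ?thesis .
  qed
  moreover have "finite W" using finB by (simp add: W_def)
  moreover have "\<forall>v\<in>W. v \<noteq> [] \<and> set v \<subseteq> gccf_index \<tau> \<and> foldr gccf_map v ` gccf_space \<subseteq> cball x r \<and>
      (\<forall>p\<in>gccf_space. \<forall>q\<in>gccf_space. c * cmod (p - q) \<le> cmod (foldr gccf_map v p - foldr gccf_map v q))"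
    unfolding W_def ball_simps
  proof (intro ballI conjI)
    fix a assume a: "a \<in> B"
    show "set (u @ [a]) \<subseteq> gccf_index \<tau>" using a BI uI by auto
    show "foldr gccf_map (u @ [a]) ` gccf_space \<subseteq> cball x r" by (rule img[OF a])
  qed (simp, rule low)
  moreover have "\<forall>v\<in>W. \<forall>v'\<in>W. v \<noteq> v' \<longrightarrow> foldr gccf_map v ` gccf_space \<inter> foldr gccf_map v' ` gccf_space = {}"
    unfolding W_def ball_simps
  proof (intro ballI impI)
    fix a a' assume "a \<in> B" "a' \<in> B" "u @ [a] \<noteq> u @ [a']"
    then show "foldr gccf_map (u @ [a]) ` gccf_space \<inter> foldr gccf_map (u @ [a']) ` gccf_space = {}"
      by (intro disj) auto
  qed
  ultimately show ?thesis using c unfolding K_def cylinder_family_def by blast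
qed

section \<open>Packing sums\<close>

text \<open>E reproduces itself only under whole words, whereas the limit set is built letter by
  letter. Adding the images of E under all finite words gives a set from which single letters can be
  stripped.\<close>

lemma attractor_subset_gccf_limit_set:
  assumes \<tau>: "\<tau> \<in> gccf_params" and E: "E \<subseteq> gccf_space" "E \<subseteq> (\<Union>u\<in>U. foldr gccf_map u ` E)"
    and U: "\<And>u. u \<in> U \<Longrightarrow> u \<noteq> [] \<and> set u \<subseteq> gccf_index \<tau>"
  shows "E \<subseteq> gccf_limit_set \<tau>"
proof -
  define F where "F = (\<Union>u\<in>lists (gccf_index \<tau>). foldr gccf_map u ` E)"
  have cons: "foldr gccf_map u x \<in> (\<Union>b\<in>gccf_index \<tau>. gccf_map b ` F)"
    if "u \<noteq> []" "set u \<subseteq> gccf_index \<tau>" "x \<in> E" for u x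
    using that by (cases u) (auto simp: F_def lists_eq_set)
  have "F \<subseteq> gccf_space"
    using E(1) gccf_index_ge(1)[OF \<tau>] unfolding F_def
    by (auto simp: lists_eq_set intro!: foldr_gccf_map_in_space)
  moreover have "F \<subseteq> (\<Union>b\<in>gccf_index \<tau>. gccf_map b ` F)"
  proof
    fix y assume "y \<in> F"
    then obtain u x where u: "set u \<subseteq> gccf_index \<tau>" "x \<in> E" "y = foldr gccf_map u x"
      by (auto simp: F_def lists_eq_set)
    show "y \<in> (\<Union>b\<in>gccf_index \<tau>. gccf_map b ` F)"
    proof (cases "u = []")
      case True
      then obtain v x' where "v \<in> U" "x' \<in> E" "y = foldr gccf_map v x'" using u E(2) by auto
      then show ?thesis using cons[of v x'] U[of v] by simp
    next
      case False
      then show ?thesis using cons u by simp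
    qed
  qed
  ultimately have "F \<subseteq> gccf_limit_set \<tau>"
    unfolding gccf_limit_set_def by (rule subset_limit_setI)
  moreover have "E \<subseteq> F" by (force simp: F_def intro: bexI[of _ "[]"])
  ultimately show ?thesis by blast
qed

lemma gccf_limit_set_subset: "gccf_limit_set \<tau> \<subseteq> gccf_space" if \<tau>: "\<tau> \<in> gccf_params"
proof
  fix x assume "x \<in> gccf_limit_set \<tau>"
  then obtain w where w: "w \<in> {w. \<forall>k. w k \<in> gccf_index \<tau>}"
    and "x \<in> (\<Inter>n\<in>{1..}. word_map gccf_map w n ` gccf_space)"
    unfolding gccf_limit_set_def limit_set_def by (rule UN_E)
  then have "x \<in> word_map gccf_map w 1 ` gccf_space" by (elim INT_D) simp
  moreover have "w 0 \<in> gccf_index \<tau>" using w by simp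
  ultimately show "x \<in> gccf_space"
    using gccf_map_in_space[OF gccf_index_ge(1)[OF \<tau>]] by auto
qed

lemma gccf_limit_set_null:
  assumes "\<tau> \<in> gccf_params" "2 < s"
  shows "hausdorff_measure s (gccf_limit_set \<tau>) = 0"
  using mem_gccf_spaceD gccf_limit_set_subset[OF assms(1)]
  by (intro hausdorff_measure_square_zero[OF _ assms(2)]) blast

lemma gccf_dim_bounds:
  assumes "\<tau> \<in> gccf_params"
  shows "0 \<le> gccf_dim \<tau>" "gccf_dim \<tau> \<le> 2"
proof -
  let ?S = "{s. 0 \<le> s \<and> hausdorff_measure s (gccf_limit_set \<tau>) = 0}"
  have S: "s \<in> ?S" if "2 < s" for s using gccf_limit_set_null[OF assms that] that by simp
  have "gccf_dim \<tau> = Inf ?S" by (simp add: gccf_dim_def hausdorff_dim_def)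
  moreover have "3 \<in> ?S" by (rule S) simp
  then have "?S \<noteq> {}" by (rule ex_in_conv[THEN iffD1, OF exI])
  then have "0 \<le> Inf ?S" by (rule cInf_greatest) simp
  moreover have "Inf ?S \<le> s" if "2 < s" for s
    using S[OF that] by (intro cInf_lower bdd_belowI[of _ 0]) auto
  then have "Inf ?S \<le> 2" by (rule dense_ge)
  ultimately show "0 \<le> gccf_dim \<tau>" "gccf_dim \<tau> \<le> 2" by simp_all
qed

text \<open>A tag accompanies each word so that the ratio may depend on the packing ball that the
  word was chosen for.\<close>

lemma gccf_subsystem_sum_le_1:
  fixes W :: "('i \<times> complex list) set"
  assumes \<tau>: "\<tau> \<in> gccf_params" and W: "finite W"
    and U: "\<And>p. p \<in> W \<Longrightarrow> snd p \<noteq> [] \<and> set (snd p) \<subseteq> gccf_index \<tau>"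
    and c: "\<And>p. p \<in> W \<Longrightarrow> 0 < c p"
    and low: "\<And>p x y. p \<in> W \<Longrightarrow> x \<in> gccf_space \<Longrightarrow> y \<in> gccf_space \<Longrightarrow>
      c p * cmod (x - y) \<le> cmod (foldr gccf_map (snd p) x - foldr gccf_map (snd p) y)"
    and disj: "\<And>p q. p \<in> W \<Longrightarrow> q \<in> W \<Longrightarrow> p \<noteq> q \<Longrightarrow>
      foldr gccf_map (snd p) ` gccf_space \<inter> foldr gccf_map (snd q) ` gccf_space = {}"
  shows "(\<Sum>p\<in>W. c p powr gccf_dim \<tau>) \<le> 1"
proof (rule ccontr)
  assume "\<not> ?thesis"
  then have gt: "1 < (\<Sum>p\<in>W. c p powr gccf_dim \<tau>)" by simp
  then have "W \<noteq> {}" by auto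
  let ?f = "\<lambda>p. foldr gccf_map (snd p)"
  have re: "1 \<le> Re b" if "p \<in> W" "b \<in> set (snd p)" for p b
    using U[OF that(1)] that(2) gccf_index_ge(1)[OF \<tau>] by blast
  have self: "?f p ` gccf_space \<subseteq> gccf_space" if "p \<in> W" for p
    using re[OF that] by (auto intro!: foldr_gccf_map_in_space)
  have cont: "continuous_on gccf_space (?f p)" if p: "p \<in> W" for p
  proof -
    obtain l where l: "0 < l" "\<And>x y. x \<in> gccf_space \<Longrightarrow> y \<in> gccf_space \<Longrightarrow> cmod (?f p x - ?f p y) \<le> 4 * l * cmod (x - y)"
      using foldr_gccf_map_distortion[of "snd p"] re[OF p] by blast
    then have "(4 * l)-lipschitz_on gccf_space (?f p)"
      by (intro lipschitz_onI) (auto simp: dist_norm)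
    then show ?thesis by (rule lipschitz_on_continuous_on)
  qed
  have inj: "inj_on (?f p) gccf_space" if p: "p \<in> W" for p
  proof (rule inj_onI)
    fix x y assume "x \<in> gccf_space" "y \<in> gccf_space" "?f p x = ?f p y"
    then show "x = y" using low[OF p, of x y] c[OF p] by (simp add: mult_le_0_iff)
  qed
  \<comment> \<open>Tested on 0 and 1, which are at distance 1 in a space of diameter 1.\<close>
  have c1: "c p \<le> 1" if p: "p \<in> W" for p
    using low[OF p zero_in_gccf_space one_in_gccf_space] self[OF p]
      gccf_space_dist_le[of "?f p 0" "?f p 1"] zero_in_gccf_space one_in_gccf_space by force
  obtain E where E: "compact E" "E \<noteq> {}" "E \<subseteq> gccf_space" "\<And>p. p \<in> W \<Longrightarrow> ?f p ` E \<subseteq> E"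
      "E \<subseteq> (\<Union>p\<in>W. ?f p ` E)"
  proof (rule exists_attractor[of W gccf_space ?f, OF W \<open>W \<noteq> {}\<close> compact_gccf_space _ cont self inj disj])
    show "gccf_space \<noteq> {}" using zero_in_gccf_space by auto
    fix E assume "compact E" "E \<noteq> {}" "E \<subseteq> gccf_space" "\<And>p. p \<in> W \<Longrightarrow> ?f p ` E \<subseteq> E"
      "E \<subseteq> (\<Union>p\<in>W. ?f p ` E)"
    then show thesis by (rule that)
  qed
  have "E \<subseteq> gccf_limit_set \<tau>"
    by (rule attractor_subset_gccf_limit_set[OF \<tau> E(3), of "snd ` W"]) (use E(5) U in auto)
  then have "gccf_dim \<tau> < hausdorff_dim (gccf_limit_set \<tau>)"
  proof (rule hausdorff_dim_gt[where f = ?f, OF W E(2,1) _ E(4) continuous_on_subset[OF cont E(3)] _ c c1])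
    show "?f p ` E \<inter> ?f q ` E = {}" if "p \<in> W" "q \<in> W" "p \<noteq> q" for p q
      using disj[OF that] E(3) by blast
    show "c p * dist x y \<le> dist (?f p x) (?f p y)" if "p \<in> W" "x \<in> E" "y \<in> E" for p x y
      using low[OF that(1), of x y] that E(3) by (auto simp: dist_norm)
    show "\<exists>s\<ge>0. hausdorff_measure s (gccf_limit_set \<tau>) = 0"
      using gccf_limit_set_null[OF \<tau>, of 3] by (intro exI[of _ 3]) simp
  qed (use gt gccf_dim_bounds[OF \<tau>] in simp_all)
  then show False by (simp add: gccf_dim_def)
qed

text \<open>The families of all balls form one system: inside a ball disjointness is built in,
  across balls it is inherited from the packing. Its ratio sum is at most 1; the factor 4 bounds
  \<open>2 powr h\<close>, from diameters in place of radii.\<close>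

lemma gccf_finite_packing_sum_le:
  assumes \<tau>: "\<tau> \<in> gccf_params" and P: "finite P"
    and mem: "\<And>x r. (x, r) \<in> P \<Longrightarrow> x \<in> gccf_limit_set \<tau> \<and> 0 < r \<and> r \<le> 1 / 4"
    and disjP: "disjoint_family_on (\<lambda>(x, r). cball x r) P"
  shows "(\<Sum>(x, r)\<in>P. (2 * r) powr gccf_dim \<tau>) \<le> 4 * (64 * (216 * (1 + cmod \<tau>)\<^sup>2))\<^sup>2"
proof -
  define h where "h = gccf_dim \<tau>"
  have h: "0 \<le> h" "h \<le> 2" using gccf_dim_bounds[OF \<tau>] by (simp_all add: h_def)
  define K where "K = (64 * (216 * (1 + cmod \<tau>)\<^sup>2))\<^sup>2"
  have "\<exists>W c. cylinder_family \<tau> W c (cball (fst p) (snd p)) \<and> snd p powr h \<le> K * (real (card W) * c powr h)"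
    if "p \<in> P" for p
    using gccf_local_cylinders[OF \<tau> h, of "fst p" "snd p", folded K_def] mem[of "fst p" "snd p"] that by simp
  then obtain W c where W: "\<And>p. p \<in> P \<Longrightarrow> cylinder_family \<tau> (W p) (c p) (cball (fst p) (snd p))"
    and mass: "\<And>p. p \<in> P \<Longrightarrow> snd p powr h \<le> K * (real (card (W p)) * c p powr h)"
    by metis
  note Wfin = W[unfolded cylinder_family_def, THEN conjunct1]
  note Wpos = W[unfolded cylinder_family_def, THEN conjunct2, THEN conjunct1]
  note Wcyl = W[unfolded cylinder_family_def, THEN conjunct2, THEN conjunct2, THEN conjunct1, THEN bspec]
  note Wdisj = W[unfolded cylinder_family_def, THEN conjunct2, THEN conjunct2, THEN conjunct2, rule_format]
  have "(\<Sum>q\<in>Sigma P W. c (fst q) powr h) \<le> 1"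
    unfolding h_def
  proof (rule gccf_subsystem_sum_le_1[OF \<tau>])
    show "finite (Sigma P W)" using P Wfin by auto
    fix q q' assume q: "q \<in> Sigma P W" and q': "q' \<in> Sigma P W" "q \<noteq> q'"
    obtain p u p' u' where eq: "q = (p, u)" "q' = (p', u')" by fastforce
    show "foldr gccf_map (snd q) ` gccf_space \<inter> foldr gccf_map (snd q') ` gccf_space = {}"
    proof (cases "p = p'")
      case True
      then show ?thesis using q q' unfolding eq snd_conv by (intro Wdisj) auto
    next
      case False
      then have "cball (fst p) (snd p) \<inter> cball (fst p') (snd p') = {}"
        using disjP q q' by (simp add: eq disjoint_family_on_def case_prod_beta)
      moreover have "foldr gccf_map u ` gccf_space \<subseteq> cball (fst p) (snd p)"
        "foldr gccf_map u' ` gccf_space \<subseteq> cball (fst p') (snd p')"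
        using Wcyl q q' by (simp_all add: eq)
      ultimately show ?thesis unfolding eq snd_conv by blast
    qed
  next
    fix q assume "q \<in> Sigma P W"
    then have q: "fst q \<in> P" "snd q \<in> W (fst q)" by auto
    show "0 < c (fst q)" by (rule Wpos[OF q(1)])
    show "snd q \<noteq> [] \<and> set (snd q) \<subseteq> gccf_index \<tau>" using Wcyl[OF q] by simp
    show "c (fst q) * cmod (x - y) \<le> cmod (foldr gccf_map (snd q) x - foldr gccf_map (snd q) y)"
      if "x \<in> gccf_space" "y \<in> gccf_space" for x y
      using Wcyl[OF q] that by simp
  qed
  also have "(\<Sum>q\<in>Sigma P W. c (fst q) powr h) = (\<Sum>p\<in>P. real (card (W p)) * c p powr h)"
    using P Wfin sum.Sigma[of P W "\<lambda>p u. c p powr h"] by (simp add: case_prod_beta)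
  finally have sum1: "(\<Sum>p\<in>P. real (card (W p)) * c p powr h) \<le> 1" .
  have "(\<Sum>(x, r)\<in>P. (2 * r) powr h) \<le> (\<Sum>p\<in>P. 4 * (K * (real (card (W p)) * c p powr h)))"
  proof (rule sum_mono)
    fix p assume p: "p \<in> P"
    obtain x r where xr: "p = (x, r)" by fastforce
    have "(2 * r) powr h = 2 powr h * r powr h" by (rule powr_mult)
    also have "\<dots> \<le> 2 powr 2 * (K * (real (card (W p)) * c p powr h))"
      using mass[OF p] h by (intro mult_mono powr_mono) (auto simp: xr)
    finally show "(case p of (x, r) \<Rightarrow> (2 * r) powr h) \<le> 4 * (K * (real (card (W p)) * c p powr h))"
      by (simp add: xr)
  qed
  also have "\<dots> = 4 * K * (\<Sum>p\<in>P. real (card (W p)) * c p powr h)" by (simp add: sum_distrib_left mult_ac)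
  also have "\<dots> \<le> 4 * K * 1" using sum1 by (intro mult_left_mono) (auto simp: K_def)
  finally show ?thesis by (simp add: h_def K_def)
qed

theorem theorem1p4:
  fixes \<tau> :: complex
  assumes "\<tau> \<in> gccf_params"
  shows "packing_measure (gccf_dim \<tau>) (gccf_limit_set \<tau>) < \<infinity>"
proof -
  define M where "M = 4 * (64 * (216 * (1 + cmod \<tau>)\<^sup>2))\<^sup>2"
  have "packing_measure (gccf_dim \<tau>) (gccf_limit_set \<tau>) \<le> packing_pre (gccf_dim \<tau>) (1/4) (gccf_limit_set \<tau>)"
    using packing_measure_le_premeasure packing_premeasure_le_pre[of "1/4"] by (rule order_trans) simp
  also have "\<dots> \<le> ennreal M"
    unfolding packing_pre_def
  proof (intro SUP_least infsum_le_finite_sums nonneg_summable_on_complete)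
    \<comment> \<open>It suffices to bound finite subsums, and a finite part of a packing is again a
      disjoint family.\<close>
    fix P F assume P: "P \<in> packings (1/4) (gccf_limit_set \<tau>)" and F: "finite F" "F \<subseteq> P"
    have "(\<Sum>(x, r)\<in>F. ennreal ((2 * r) powr gccf_dim \<tau>)) = ennreal (\<Sum>(x, r)\<in>F. (2 * r) powr gccf_dim \<tau>)"
      by (subst sum_ennreal[symmetric]) (auto simp: case_prod_beta)
    also have "\<dots> \<le> ennreal M"
      unfolding M_def
    proof (intro ennreal_leI gccf_finite_packing_sum_le assms F)
      show "disjoint_family_on (\<lambda>(x, r). cball x r) F"
        using P F by (intro disjoint_family_on_mono[OF F(2)]) (auto simp: packings_def)
    qed (use P F in \<open>auto simp: packings_def\<close>)
    finally show "(\<Sum>(x, r)\<in>F. ennreal ((2 * r) powr gccf_dim \<tau>)) \<le> ennreal M" .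
  qed auto
  also have "\<dots> < \<infinity>" by simp
  finally show ?thesis .
qed

end
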